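(* For a left and right coherent ring $R$, an absolutely pure left $R$-module does not in general have a decomposition as a direct sum of indecomposable absolutely pure submodules; that is, there exist a left and right coherent ring $R$ and an absolutely pure left $R$-module which is not a direct sum of indecomposable absolutely pure submodules.
   Context: All rings are associative with identity; modules are unital. A left $R$-module $M$ is absolutely pure (also called FP-injective) if it is a pure submodule of every left $R$-module that contains it. A submodule $M\subseteq N$ is pure if the short exact sequence $0\to M\to N\to N/M\to 0$ remains exact under $\operatorname{Hom}_R(F,-)$ for every finitely presented left $R$-module $F$. A ring is left (resp. right) coherent if every finitely generated left (resp. right) ideal is finitely presented. *)

theory Defs
  imports "HOL-Algebra.Module" "HOL-Algebra.AbelCoset"
begin

section \<open>Left modules over an arbitrary ring\<close>

text \<open>The locale \<^locale>\<open>module\<close> of \<open>HOL-Algebra\<close> requires a commutative ring of scalars. The records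
  and the locale \<^locale>\<open>submodule\<close> do not, and are reused. The fields \<open>mult\<close> and \<open>one\<close> of a module
  record carry no meaning.\<close>

locale left_module = R?: ring R + M?: abelian_group M
  for R :: "'r ring" (structure) and M :: "('r, 'm) module" (structure) +
  assumes smult_closed [simp, intro]:
      "\<lbrakk>a \<in> carrier R; x \<in> carrier M\<rbrakk> \<Longrightarrow> a \<odot>\<^bsub>M\<^esub> x \<in> carrier M"
    and smult_l_distr:
      "\<lbrakk>a \<in> carrier R; b \<in> carrier R; x \<in> carrier M\<rbrakk>
        \<Longrightarrow> (a \<oplus> b) \<odot>\<^bsub>M\<^esub> x = a \<odot>\<^bsub>M\<^esub> x \<oplus>\<^bsub>M\<^esub> b \<odot>\<^bsub>M\<^esub> x"
    and smult_r_distr: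
      "\<lbrakk>a \<in> carrier R; x \<in> carrier M; y \<in> carrier M\<rbrakk>
        \<Longrightarrow> a \<odot>\<^bsub>M\<^esub> (x \<oplus>\<^bsub>M\<^esub> y) = a \<odot>\<^bsub>M\<^esub> x \<oplus>\<^bsub>M\<^esub> a \<odot>\<^bsub>M\<^esub> y"
    and smult_assoc1:
      "\<lbrakk>a \<in> carrier R; b \<in> carrier R; x \<in> carrier M\<rbrakk>
        \<Longrightarrow> (a \<otimes> b) \<odot>\<^bsub>M\<^esub> x = a \<odot>\<^bsub>M\<^esub> (b \<odot>\<^bsub>M\<^esub> x)"
    and smult_one [simp]: "x \<in> carrier M \<Longrightarrow> \<one> \<odot>\<^bsub>M\<^esub> x = x"

abbreviation sub_module :: "('r, 'm) module \<Rightarrow> 'm set \<Rightarrow> ('r, 'm) module"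
  where "sub_module M H \<equiv> M\<lparr>carrier := H\<rparr>"

definition quotient_module :: "('r, 'm) module \<Rightarrow> 'm set \<Rightarrow> ('r, 'm set) module"
  where "quotient_module M H =
    \<lparr>carrier = a_rcosets\<^bsub>M\<^esub> H, mult = undefined, one = undefined, zero = H, add = set_add M,
     smult = \<lambda>r C. \<Union>x\<in>C. H +>\<^bsub>M\<^esub> (r \<odot>\<^bsub>M\<^esub> x)\<rparr>"

definition quotient_map :: "('r, 'm) module \<Rightarrow> 'm set \<Rightarrow> 'm \<Rightarrow> 'm set"
  where "quotient_map M H = (\<lambda>x\<in>carrier M. H +>\<^bsub>M\<^esub> x)"

text \<open>Homomorphisms are extensional functions, so that distinct elements of
  \<open>left_module_hom R M N\<close> are distinct maps on the carrier of \<open>M\<close>.\<close>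

definition left_module_hom :: "'r ring \<Rightarrow> ('r, 'm) module \<Rightarrow> ('r, 'n) module \<Rightarrow> ('m \<Rightarrow> 'n) set"
  where "left_module_hom R M N =
    {f \<in> extensional (carrier M) \<inter> hom (add_monoid M) (add_monoid N).
      \<forall>r\<in>carrier R. \<forall>x\<in>carrier M. f (r \<odot>\<^bsub>M\<^esub> x) = r \<odot>\<^bsub>N\<^esub> f x}"

definition hom_group :: "'r ring \<Rightarrow> ('r, 'm) module \<Rightarrow> ('r, 'n) module \<Rightarrow> ('m \<Rightarrow> 'n) monoid"
  where "hom_group R M N =
    \<lparr>carrier = left_module_hom R M N,
     mult = \<lambda>f g. \<lambda>x\<in>carrier M. f x \<oplus>\<^bsub>N\<^esub> g x,
     one = \<lambda>x\<in>carrier M. \<zero>\<^bsub>N\<^esub>\<rparr>"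

definition regular_module :: "'r ring \<Rightarrow> ('r, 'r) module"
  where "regular_module R =
    \<lparr>carrier = carrier R, mult = undefined, one = undefined, zero = \<zero>\<^bsub>R\<^esub>, add = add R,
     smult = mult R\<rparr>"

definition free_module :: "'r ring \<Rightarrow> nat \<Rightarrow> ('r, nat \<Rightarrow> 'r) module"
  where "free_module R n =
    \<lparr>carrier = {..<n} \<rightarrow>\<^sub>E carrier R, mult = undefined, one = undefined,
     zero = \<lambda>i\<in>{..<n}. \<zero>\<^bsub>R\<^esub>,
     add = \<lambda>v w. \<lambda>i\<in>{..<n}. v i \<oplus>\<^bsub>R\<^esub> w i,
     smult = \<lambda>r v. \<lambda>i\<in>{..<n}. r \<otimes>\<^bsub>R\<^esub> v i\<rparr>"


section \<open>Finite generation, finite presentation, coherence\<close>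

definition finitely_generated :: "'r ring \<Rightarrow> ('r, 'm) module \<Rightarrow> bool"
  where "finitely_generated R M \<longleftrightarrow>
    (\<exists>A. finite A \<and> A \<subseteq> carrier M \<and> (\<forall>H. submodule H R M \<and> A \<subseteq> H \<longrightarrow> H = carrier M))"

definition finitely_presented :: "'r ring \<Rightarrow> ('r, 'm) module \<Rightarrow> bool"
  where "finitely_presented R F \<longleftrightarrow> left_module R F \<and>
    (\<exists>n. \<exists>p \<in> left_module_hom R (free_module R n) F.
      p ` carrier (free_module R n) = carrier F \<and>
      finitely_generated R (sub_module (free_module R n) (a_kernel (free_module R n) F p)))"

definition left_coherent :: "'r ring \<Rightarrow> bool"
  where "left_coherent R \<longleftrightarrow>
    (\<forall>I. submodule I R (regular_module R) \<and> finitely_generated R (sub_module (regular_module R) I)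
      \<longrightarrow> finitely_presented R (sub_module (regular_module R) I))"

text \<open>Right \<open>R\<close>-modules are left modules over the opposite ring.\<close>

definition opposite_ring :: "'r ring \<Rightarrow> 'r ring"
  where "opposite_ring R = R\<lparr>mult := \<lambda>x y. y \<otimes>\<^bsub>R\<^esub> x\<rparr>"

definition right_coherent :: "'r ring \<Rightarrow> bool"
  where "right_coherent R \<longleftrightarrow> left_coherent (opposite_ring R)"


section \<open>Purity\<close>

definition short_exact ::
    "'a monoid \<Rightarrow> ('a \<Rightarrow> 'b) \<Rightarrow> 'b monoid \<Rightarrow> ('b \<Rightarrow> 'c) \<Rightarrow> 'c monoid \<Rightarrow> bool"
  where "short_exact A f B g C \<longleftrightarrow>
    f \<in> hom A B \<and> g \<in> hom B C \<and>
    inj_on f (carrier A) \<and> f ` carrier A = kernel B C g \<and> g ` carrier B = carrier C"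

definition hom_exact :: "'r ring \<Rightarrow> ('r, 'f) module \<Rightarrow> 'n set \<Rightarrow> ('r, 'n) module \<Rightarrow> bool"
  where "hom_exact R F H N \<longleftrightarrow>
    short_exact
      (hom_group R F (sub_module N H)) (compose (carrier F) (\<lambda>x\<in>H. x))
      (hom_group R F N) (compose (carrier F) (quotient_map N H))
      (hom_group R F (quotient_module N H))"

text \<open>The test modules \<open>F\<close> range over a fixed type. That type contains \<open>R\<^sup>n / K\<close> for all \<open>n\<close> and \<open>K\<close>,
  hence an isomorphic copy of every finitely presented module; see \<open>pure_submodule_hom_exact\<close>.\<close>

definition pure_submodule :: "'r ring \<Rightarrow> 'n set \<Rightarrow> ('r, 'n) module \<Rightarrow> bool"
  where "pure_submodule R H N \<longleftrightarrow> submodule H R N \<and>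
    (\<forall>F :: ('r, (nat \<Rightarrow> 'r) set) module. finitely_presented R F \<longrightarrow> hom_exact R F H N)"

text \<open>The modules \<open>N\<close> containing \<open>M\<close> also range over a fixed type, chosen large enough to contain, up
  to isomorphism over \<open>M\<close>, every \<open>N\<close> for which \<open>N / M\<close> is finitely generated. This entails purity
  in all left modules containing \<open>M\<close>, over any type; see \<open>absolutely_pure_pure_submodule\<close>.
  Containment is expressed by an injective homomorphism, as \<open>M\<close> and \<open>N\<close> have different types.\<close>

definition absolutely_pure :: "'r ring \<Rightarrow> ('r, 'm) module \<Rightarrow> bool"
  where "absolutely_pure R M \<longleftrightarrow> left_module R M \<and>
    (\<forall>N :: ('r, ('m \<times> (nat \<Rightarrow> 'r)) set) module. left_module R N \<longrightarrow>
      (\<forall>j \<in> left_module_hom R M N. inj_on j (carrier M) \<longrightarrow>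
        pure_submodule R (j ` carrier M) N))"


section \<open>Direct sums and indecomposable modules\<close>

definition indecomposable :: "'r ring \<Rightarrow> ('r, 'm) module \<Rightarrow> bool"
  where "indecomposable R M \<longleftrightarrow> carrier M \<noteq> {\<zero>\<^bsub>M\<^esub>} \<and>
    (\<forall>A B. submodule A R M \<and> submodule B R M \<and> A \<inter> B = {\<zero>\<^bsub>M\<^esub>} \<and> A <+>\<^bsub>M\<^esub> B = carrier M
      \<longrightarrow> A = {\<zero>\<^bsub>M\<^esub>} \<or> B = {\<zero>\<^bsub>M\<^esub>})"

text \<open>A set of submodules suffices in place of an indexed family: nonzero members of a family whose
  sum is direct are pairwise distinct. The empty set decomposes the zero module.\<close>

definition internal_direct_sum :: "'r ring \<Rightarrow> ('r, 'm) module \<Rightarrow> 'm set set \<Rightarrow> bool"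
  where "internal_direct_sum R M \<N> \<longleftrightarrow>
    (\<forall>N\<in>\<N>. submodule N R M) \<and>
    (\<forall>x\<in>carrier M. \<exists>!f. f \<in> (\<Pi>\<^sub>E N\<in>\<N>. N) \<and> finite {N \<in> \<N>. f N \<noteq> \<zero>\<^bsub>M\<^esub>} \<and>
      x = (\<Oplus>\<^bsub>M\<^esub>N\<in>{N \<in> \<N>. f N \<noteq> \<zero>\<^bsub>M\<^esub>}. f N))"


section \<open>Independence of the chosen types\<close>

text \<open>Purity and absolute purity were defined with test modules over fixed types. The two theorems of
  this section show that they imply the same conditions for test modules over arbitrary types.\<close>

lemma left_module_homD:
  assumes "f \<in> left_module_hom R M N"
  shows "f \<in> extensional (carrier M)" "\<And>x. x \<in> carrier M \<Longrightarrow> f x \<in> carrier N"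
    "\<And>x y. x \<in> carrier M \<Longrightarrow> y \<in> carrier M \<Longrightarrow> f (x \<oplus>\<^bsub>M\<^esub> y) = f x \<oplus>\<^bsub>N\<^esub> f y"
    "\<And>r x. r \<in> carrier R \<Longrightarrow> x \<in> carrier M \<Longrightarrow> f (r \<odot>\<^bsub>M\<^esub> x) = r \<odot>\<^bsub>N\<^esub> f x"
  using assms by (auto simp: left_module_hom_def hom_def)

lemma left_module_homI:
  assumes "f \<in> extensional (carrier M)" "\<And>x. x \<in> carrier M \<Longrightarrow> f x \<in> carrier N"
    "\<And>x y. x \<in> carrier M \<Longrightarrow> y \<in> carrier M \<Longrightarrow> f (x \<oplus>\<^bsub>M\<^esub> y) = f x \<oplus>\<^bsub>N\<^esub> f y"
    "\<And>r x. r \<in> carrier R \<Longrightarrow> x \<in> carrier M \<Longrightarrow> f (r \<odot>\<^bsub>M\<^esub> x) = r \<odot>\<^bsub>N\<^esub> f x"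
  shows "f \<in> left_module_hom R M N"
  using assms by (auto simp: left_module_hom_def hom_def)

lemma (in left_module) smult_l_null:
  assumes "x \<in> carrier M"
  shows "\<zero> \<odot>\<^bsub>M\<^esub> x = \<zero>\<^bsub>M\<^esub>"
  using smult_l_distr[of \<zero> \<zero> x] assms by (metis M.add.r_cancel_one' R.l_zero R.zero_closed smult_closed)

lemma (in left_module) smult_minus_one:
  assumes "x \<in> carrier M"
  shows "(\<ominus> \<one>) \<odot>\<^bsub>M\<^esub> x = \<ominus>\<^bsub>M\<^esub> x"
  using smult_l_distr[of "\<ominus> \<one>" \<one> x] assms
  by (intro M.minus_equality[symmetric]) (auto simp: R.l_neg smult_l_null)

lemma left_module_hom_compose:
  assumes "left_module R M" "f \<in> left_module_hom R M N" "g \<in> left_module_hom R N P"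
  shows "compose (carrier M) g f \<in> left_module_hom R M P"
proof -
  interpret left_module R M by fact
  show ?thesis
    by (rule left_module_homI)
       (auto simp: left_module_homD[OF assms(2)] left_module_homD[OF assms(3)] compose_def)
qed

lemma left_module_hom_zero:
  assumes "left_module R M" "left_module R N" "f \<in> left_module_hom R M N"
  shows "f \<zero>\<^bsub>M\<^esub> = \<zero>\<^bsub>N\<^esub>"
proof -
  interpret M: left_module R M by fact
  interpret N: left_module R N by fact
  have "f \<zero>\<^bsub>M\<^esub> = f \<zero>\<^bsub>M\<^esub> \<oplus>\<^bsub>N\<^esub> f \<zero>\<^bsub>M\<^esub>"
    using left_module_homD(3)[OF assms(3), of "\<zero>\<^bsub>M\<^esub>" "\<zero>\<^bsub>M\<^esub>"] by simp
  then show ?thesis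
    using left_module_homD(2)[OF assms(3), of "\<zero>\<^bsub>M\<^esub>"]
    by (metis M.M.zero_closed N.M.add.r_cancel_one')
qed

lemma image_left_module_hom_submodule:
  assumes "left_module R M" "left_module R N" "f \<in> left_module_hom R M N"
  shows "submodule (f ` carrier M) R N"
proof -
  interpret M: left_module R M by fact
  interpret N: left_module R N by fact
  note f = left_module_homD[OF assms(3)]
  have inv: "inv\<^bsub>add_monoid N\<^esub> (f x) = f (\<ominus>\<^bsub>M\<^esub> x)" if "x \<in> carrier M" for x
  proof -
    have "f (\<ominus>\<^bsub>M\<^esub> x) \<oplus>\<^bsub>N\<^esub> f x = \<zero>\<^bsub>N\<^esub>"
      using that f(3)[of "\<ominus>\<^bsub>M\<^esub> x" x] left_module_hom_zero[OF assms]
      by (simp add: M.M.l_neg)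
    then have "\<ominus>\<^bsub>N\<^esub> (f x) = f (\<ominus>\<^bsub>M\<^esub> x)"
      using that f(2) by (intro N.M.minus_equality) auto
    then show ?thesis by (simp add: a_inv_def)
  qed
  show ?thesis
  proof (intro submodule.intro subgroup.intro submodule_axioms.intro)
    show "\<one>\<^bsub>add_monoid N\<^esub> \<in> f ` carrier M"
      using left_module_hom_zero[OF assms] by (simp add: image_iff) (metis M.M.zero_closed)
    show "inv\<^bsub>add_monoid N\<^esub> x \<in> f ` carrier M" if "x \<in> f ` carrier M" for x
      using that by (auto simp: inv)
  qed (use f in \<open>auto simp flip: f(3,4)\<close>)
qed

context
  fixes R :: "'r ring" and N :: "('r, 'n) module" and H
  assumes N: "left_module R N" and H: "submodule H R N"
begin

interpretation N: left_module R N by (rule N)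

interpretation H: abelian_subgroup H N
  using H N.M.abelian_group_axioms
  by (intro abelian_subgroupI3 additive_subgroup.intro) (auto simp: submodule_def)

lemma coset_eq_iff:
  assumes "x \<in> carrier N" "y \<in> carrier N"
  shows "H +>\<^bsub>N\<^esub> x = H +>\<^bsub>N\<^esub> y \<longleftrightarrow> y \<in> H +>\<^bsub>N\<^esub> x"
  using assms H.a_rcos_self N.M.a_repr_independence H.a_subgroup by metis

lemma smult_coset:
  assumes r: "r \<in> carrier R" and x: "x \<in> carrier N"
  shows "(\<Union>y\<in>H +>\<^bsub>N\<^esub> x. H +>\<^bsub>N\<^esub> (r \<odot>\<^bsub>N\<^esub> y)) = H +>\<^bsub>N\<^esub> (r \<odot>\<^bsub>N\<^esub> x)"
proof -
  have "H +>\<^bsub>N\<^esub> (r \<odot>\<^bsub>N\<^esub> y) = H +>\<^bsub>N\<^esub> (r \<odot>\<^bsub>N\<^esub> x)" if y: "y \<in> H +>\<^bsub>N\<^esub> x" for y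
  proof -
    obtain h where h: "h \<in> H" "y = h \<oplus>\<^bsub>N\<^esub> x" using y by (auto simp: a_r_coset_def')
    have hN: "h \<in> carrier N" using h(1) H.a_subset by auto
    have "r \<odot>\<^bsub>N\<^esub> y = r \<odot>\<^bsub>N\<^esub> h \<oplus>\<^bsub>N\<^esub> r \<odot>\<^bsub>N\<^esub> x"
      using h hN x r by (simp add: N.smult_r_distr)
    moreover have "r \<odot>\<^bsub>N\<^esub> h \<in> H" using submodule.smult_closed[OF H] r h(1) by auto
    ultimately have "r \<odot>\<^bsub>N\<^esub> y \<in> H +>\<^bsub>N\<^esub> (r \<odot>\<^bsub>N\<^esub> x)" by (auto simp: a_r_coset_def')
    then show ?thesis using coset_eq_iff[of "r \<odot>\<^bsub>N\<^esub> x" "r \<odot>\<^bsub>N\<^esub> y"] h(2) hN r x by auto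
  qed
  then show ?thesis using H.a_rcos_self[OF x] by blast
qed

lemma quotient_map_hom: "quotient_map N H \<in> left_module_hom R N (quotient_module N H)"
  by (rule left_module_homI)
     (auto simp: quotient_map_def quotient_module_def smult_coset H.a_rcos_sum
         N.M.a_rcosetsI H.a_subset)

lemma quotient_map_eq_zero_iff:
  assumes "x \<in> carrier N"
  shows "quotient_map N H x = \<zero>\<^bsub>quotient_module N H\<^esub> \<longleftrightarrow> x \<in> H"
  using assms coset_eq_iff[of "\<zero>\<^bsub>N\<^esub>" x] H.a_subset
  by (auto simp: quotient_map_def quotient_module_def)

lemma carrier_quotient_module: "carrier (quotient_module N H) = quotient_map N H ` carrier N"
  by (auto simp: quotient_module_def quotient_map_def A_RCOSETS_def' )

lemma quotient_map_eq_iff: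
  assumes "x \<in> carrier N" "y \<in> carrier N"
  shows "quotient_map N H x = quotient_map N H y \<longleftrightarrow> (\<exists>h\<in>H. y = h \<oplus>\<^bsub>N\<^esub> x)"
  using assms coset_eq_iff by (auto simp: quotient_map_def a_r_coset_def')

lemma hom_exact_iff:
  assumes F: "left_module R F"
  shows "hom_exact R F H N \<longleftrightarrow>
    (\<forall>g \<in> left_module_hom R F (quotient_module N H). \<exists>h \<in> left_module_hom R F N.
       compose (carrier F) (quotient_map N H) h = g)" (is "_ \<longleftrightarrow> ?R")
proof -
  interpret F: left_module R F by fact
  let ?q = "quotient_map N H" and ?Q = "quotient_module N H"
  let ?A = "hom_group R F (sub_module N H)" and ?B = "hom_group R F N"
    and ?C = "hom_group R F ?Q"
  let ?i = "compose (carrier F) (\<lambda>x\<in>H. x)" and ?p = "compose (carrier F) ?q"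
  have i: "?i f = f" if "f \<in> left_module_hom R F (sub_module N H)" for f
    using left_module_homD(1,2)[OF that] by (auto simp: compose_def extensional_def fun_eq_iff)
  have sub: "left_module_hom R F (sub_module N H) =
      {f \<in> left_module_hom R F N. f \<in> carrier F \<rightarrow> H}"
    using H.a_subset by (auto simp: left_module_hom_def hom_def)
  have p: "?p f \<in> left_module_hom R F ?Q" if "f \<in> left_module_hom R F N" for f
    using left_module_hom_compose[OF F that quotient_map_hom] .
  have "?i \<in> hom ?A ?B"
    unfolding hom_group_def hom_def
    by (auto simp: i sub) (auto simp: compose_def fun_eq_iff Pi_iff left_module_hom_def hom_def H.a_closed)
  moreover have "?p \<in> hom ?B ?C"
    using left_module_homD(3)[OF quotient_map_hom]
    by (auto simp: hom_group_def hom_def p) 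
       (auto simp: compose_def fun_eq_iff left_module_homD(2))
  moreover have "inj_on ?i (carrier ?A)"
    by (auto simp: hom_group_def i intro!: inj_onI)
  moreover have "?i ` carrier ?A = kernel ?B ?C ?p"
  proof -
    have "?i ` carrier ?A = {f \<in> left_module_hom R F N. f \<in> carrier F \<rightarrow> H}"
      by (simp add: hom_group_def i sub[symmetric])
    also have "\<dots> = kernel ?B ?C ?p"
    proof -
      have "f \<in> carrier F \<rightarrow> H \<longleftrightarrow> ?p f = \<one>\<^bsub>?C\<^esub>" if f: "f \<in> left_module_hom R F N" for f
      proof -
        have "f x \<in> H \<longleftrightarrow> ?q (f x) = \<zero>\<^bsub>?Q\<^esub>" if "x \<in> carrier F" for x
          using quotient_map_eq_zero_iff left_module_homD(2)[OF f that] by simp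
        then show ?thesis
          by (auto simp: hom_group_def compose_def fun_eq_iff Pi_iff restrict_def simp del: not_all)
      qed
      then show ?thesis by (auto simp: kernel_def hom_group_def)
    qed
    finally show ?thesis .
  qed
  moreover have "?p ` carrier ?B = carrier ?C \<longleftrightarrow> ?R"
    using p by (simp add: hom_group_def set_eq_iff image_iff) metis
  ultimately show ?thesis unfolding hom_exact_def short_exact_def by blast
qed

end

lemma left_module_transport:
  assumes A: "left_module R (A :: ('r, 'a) module)" and c: "inj_on c (carrier A)"
  obtains B :: "('r, 'b) module" where "left_module R B" "carrier B = c ` carrier A"
    "restrict c (carrier A) \<in> left_module_hom R A B"
    "restrict (inv_into (carrier A) c) (carrier B) \<in> left_module_hom R B A"
proof
  interpret A: left_module R A by fact
  let ?d = "inv_into (carrier A) c"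
  define B :: "('r, 'b) module" where "B =
    \<lparr>carrier = c ` carrier A, mult = undefined, one = undefined, zero = c \<zero>\<^bsub>A\<^esub>,
     add = \<lambda>x y. c (?d x \<oplus>\<^bsub>A\<^esub> ?d y), smult = \<lambda>r x. c (r \<odot>\<^bsub>A\<^esub> ?d x)\<rparr>"
  have B: "carrier B = c ` carrier A" "\<zero>\<^bsub>B\<^esub> = c \<zero>\<^bsub>A\<^esub>"
    "\<And>x y. x \<oplus>\<^bsub>B\<^esub> y = c (?d x \<oplus>\<^bsub>A\<^esub> ?d y)" "\<And>r x. r \<odot>\<^bsub>B\<^esub> x = c (r \<odot>\<^bsub>A\<^esub> ?d x)"
    by (auto simp: B_def)
  have d: "?d (c x) = x" if "x \<in> carrier A" for x using c that by auto
  have "abelian_group B"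
  proof (rule abelian_groupI)
    show "\<exists>y\<in>carrier B. y \<oplus>\<^bsub>B\<^esub> x = \<zero>\<^bsub>B\<^esub>" if "x \<in> carrier B" for x
      using that by (auto simp: B d A.M.l_neg intro!: bexI[of _ "\<ominus>\<^bsub>A\<^esub> _"])
  qed (auto simp: B d A.M.a_assoc A.M.a_comm A.M.a_lcomm)
  then show "left_module R B"
    by (intro left_module.intro left_module_axioms.intro)
       (auto simp: B d A.R.ring_axioms A.smult_l_distr A.smult_r_distr A.smult_assoc1)
  show "carrier B = c ` carrier A" by (fact B)
  show "restrict c (carrier A) \<in> left_module_hom R A B"
    by (rule left_module_homI) (auto simp: B d)
  show "restrict ?d (carrier B) \<in> left_module_hom R B A"
    by (rule left_module_homI) (auto simp: B d inj_on_eq_iff[OF c])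
qed

lemma finitely_presented_iso:
  assumes F: "finitely_presented R F" and G: "left_module R G"
    and f: "f \<in> left_module_hom R F G" "bij_betw f (carrier F) (carrier G)"
  shows "finitely_presented R G"
proof -
  have Fm: "left_module R F" using F by (simp add: finitely_presented_def)
  interpret F: left_module R F by fact
  interpret G: left_module R G by fact
  obtain n p where p: "p \<in> left_module_hom R (free_module R n) F"
      "p ` carrier (free_module R n) = carrier F"
      "finitely_generated R (sub_module (free_module R n) (a_kernel (free_module R n) F p))"
    using F by (auto simp: finitely_presented_def)
  let ?E = "free_module R n" and ?p = "compose (carrier (free_module R n)) f p"
  have "?p \<in> left_module_hom R ?E G"
  proof (rule left_module_homI)
    fix x y assume xy: "x \<in> carrier ?E" "y \<in> carrier ?E"
    have "x \<oplus>\<^bsub>?E\<^esub> y \<in> carrier ?E" using xy by (auto simp: free_module_def)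
    then show "?p (x \<oplus>\<^bsub>?E\<^esub> y) = ?p x \<oplus>\<^bsub>G\<^esub> ?p y"
      using xy by (simp add: compose_def left_module_homD[OF p(1)] left_module_homD[OF f(1)])
  next
    fix r x assume xy: "r \<in> carrier R" "x \<in> carrier ?E"
    have "r \<odot>\<^bsub>?E\<^esub> x \<in> carrier ?E" using xy by (auto simp: free_module_def)
    then show "?p (r \<odot>\<^bsub>?E\<^esub> x) = r \<odot>\<^bsub>G\<^esub> ?p x"
      using xy by (simp add: compose_def left_module_homD[OF p(1)] left_module_homD[OF f(1)])
  qed (auto simp: compose_def left_module_homD[OF p(1)] left_module_homD[OF f(1)])
  moreover have "?p ` carrier ?E = carrier G"
  proof -
    have "?p ` carrier ?E = f ` p ` carrier ?E" by (auto simp: compose_def)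
    then show ?thesis using p(2) f(2) by (simp add: bij_betw_def)
  qed
  moreover have "a_kernel ?E G ?p = a_kernel ?E F p"
  proof -
    have "f y = \<zero>\<^bsub>G\<^esub> \<longleftrightarrow> y = \<zero>\<^bsub>F\<^esub>" if "y \<in> carrier F" for y
      using that left_module_hom_zero[OF Fm G f(1)] f(2)
      by (metis F.M.zero_closed bij_betw_def inj_on_def)
    then show ?thesis
      using left_module_homD(2)[OF p(1)] by (auto simp: a_kernel_def' compose_def)
  qed
  ultimately show ?thesis using p(3) G unfolding finitely_presented_def
    by (intro conjI exI[of _ n] bexI[of _ ?p]) simp_all
qed

lemma finitely_presented_copy:
  assumes F: "finitely_presented R (F :: ('r, 'f) module)"
  obtains F' :: "('r, (nat \<Rightarrow> 'r) set) module" and a b where "finitely_presented R F'"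
    "a \<in> left_module_hom R F F'" "b \<in> left_module_hom R F' F"
    "\<And>x. x \<in> carrier F \<Longrightarrow> b (a x) = x"
proof -
  have Fm: "left_module R F" using F by (simp add: finitely_presented_def)
  obtain n p where p: "p \<in> left_module_hom R (free_module R n) F"
      "p ` carrier (free_module R n) = carrier F"
    using F by (auto simp: finitely_presented_def)
  define c where "c = (\<lambda>x. {v \<in> carrier (free_module R n). p v = x})"
  have c: "inj_on c (carrier F)"
    unfolding c_def p(2)[symmetric] by (rule inj_onI) blast
  obtain F' :: "('r, (nat \<Rightarrow> 'r) set) module" where F': "left_module R F'"
    "carrier F' = c ` carrier F" "restrict c (carrier F) \<in> left_module_hom R F F'"
    "restrict (inv_into (carrier F) c) (carrier F') \<in> left_module_hom R F' F"
    using left_module_transport[OF Fm c] by blast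
  have "bij_betw (restrict c (carrier F)) (carrier F) (carrier F')"
    using c F'(2) by (simp add: bij_betw_def)
  from finitely_presented_iso[OF F F'(1,3) this] F'(3,4) show ?thesis
    by (rule that) (use c F'(2) in auto)
qed

theorem pure_submodule_hom_exact:
  assumes N: "left_module R N" and H: "pure_submodule R H N"
    and F: "finitely_presented R (F :: ('r, 'f) module)"
  shows "hom_exact R F H N"
proof -
  have Hs: "submodule H R N" using H by (simp add: pure_submodule_def)
  have Fm: "left_module R F" using F by (simp add: finitely_presented_def)
  obtain F' :: "('r, (nat \<Rightarrow> 'r) set) module" and a b where F': "finitely_presented R F'"
    and a: "a \<in> left_module_hom R F F'" and b: "b \<in> left_module_hom R F' F"
    and ba: "\<And>x. x \<in> carrier F \<Longrightarrow> b (a x) = x"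
    using finitely_presented_copy[OF F] by blast
  have F'm: "left_module R F'" using F' by (simp add: finitely_presented_def)
  have ex: "hom_exact R F' H N" using H F' by (simp add: pure_submodule_def)
  show ?thesis unfolding hom_exact_iff[OF N Hs Fm]
  proof
    fix g assume g: "g \<in> left_module_hom R F (quotient_module N H)"
    have "compose (carrier F') g b \<in> left_module_hom R F' (quotient_module N H)"
      by (rule left_module_hom_compose[OF F'm b g])
    then obtain h where h: "h \<in> left_module_hom R F' N"
      "compose (carrier F') (quotient_map N H) h = compose (carrier F') g b"
      using ex unfolding hom_exact_iff[OF N Hs F'm] by blast
    have "compose (carrier F) (quotient_map N H) (compose (carrier F) h a) = g"
    proof
      fix x show "compose (carrier F) (quotient_map N H) (compose (carrier F) h a) x = g x"
      proof (cases "x \<in> carrier F")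
        case True
        then show ?thesis using fun_cong[OF h(2), of "a x"] left_module_homD(2)[OF a True] ba
          by (simp add: compose_def)
      next
        case False
        then show ?thesis using left_module_homD(1)[OF g]
          by (simp add: compose_def extensional_def)
      qed
    qed
    then show "\<exists>h\<in>left_module_hom R F N. compose (carrier F) (quotient_map N H) h = g"
      using left_module_hom_compose[OF Fm a h(1)] by blast
  qed
qed

lemma left_module_sub_module:
  assumes N: "left_module R N" and H: "submodule H R N"
  shows "left_module R (sub_module N H)"
proof -
  interpret N: left_module R N by fact
  have s: "subgroup H (add_monoid N)" using H by (simp add: submodule_def)
  interpret H: additive_subgroup H N using s by (simp add: additive_subgroup_def)
  have "abelian_group (sub_module N H)"
  proof (rule abelian_groupI)
    show "\<exists>y\<in>carrier (sub_module N H). y \<oplus>\<^bsub>sub_module N H\<^esub> x = \<zero>\<^bsub>sub_module N H\<^esub>"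
      if "x \<in> carrier (sub_module N H)" for x
    proof -
      have "\<ominus>\<^bsub>N\<^esub> x \<in> H" using that subgroup.m_inv_closed[OF s] by (simp add: a_inv_def)
      moreover have "\<ominus>\<^bsub>N\<^esub> x \<oplus>\<^bsub>N\<^esub> x = \<zero>\<^bsub>N\<^esub>" using that H.a_subset by (auto intro: N.M.l_neg)
      ultimately show ?thesis by auto
    qed
  qed (use H.a_subset in \<open>auto simp: N.M.a_assoc N.M.a_comm N.M.a_lcomm H.a_closed subset_iff\<close>)
  then show ?thesis
    using subgroup.subset[OF s] submodule.smult_closed[OF H]
    by (intro left_module.intro left_module_axioms.intro)
       (auto simp: N.R.ring_axioms N.smult_l_distr N.smult_r_distr N.smult_assoc1 subset_iff)
qed

theorem absolutely_pure_pure_submodule: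
  fixes M :: "('r, 'm) module" and N :: "('r, 'n) module"
  assumes M: "absolutely_pure R M" and N: "left_module R N"
    and j: "j \<in> left_module_hom R M N" "inj_on j (carrier M)"
  shows "pure_submodule R (j ` carrier M) N"
proof -
  have Mm: "left_module R M" using M by (simp add: absolutely_pure_def)
  interpret N: left_module R N by fact
  define H where "H = j ` carrier M"
  have H: "submodule H R N" unfolding H_def by (rule image_left_module_hom_submodule[OF Mm N j(1)])
  interpret H: abelian_subgroup H N
    using H N.M.abelian_group_axioms
    by (intro abelian_subgroupI3 additive_subgroup.intro) (auto simp: submodule_def)
  let ?Q = "quotient_module N H" and ?q = "quotient_map N H"
  note q = left_module_homD[OF quotient_map_hom[OF N H]]
  have "hom_exact R F H N" if F: "finitely_presented R F" for F :: "('r, (nat \<Rightarrow> 'r) set) module"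
  proof -
    have Fm: "left_module R F" using F by (simp add: finitely_presented_def)
    interpret F: left_module R F by fact
    obtain n p where p: "p \<in> left_module_hom R (free_module R n) F"
        "p ` carrier (free_module R n) = carrier F"
      using F by (auto simp: finitely_presented_def)
    show ?thesis unfolding hom_exact_iff[OF N H Fm]
    proof
      fix g assume g: "g \<in> left_module_hom R F ?Q"
      note g' = left_module_homD[OF g]
      define S where "S = {y \<in> carrier N. ?q y \<in> g ` carrier F}"
      have q0: "?q \<zero>\<^bsub>N\<^esub> = g \<zero>\<^bsub>F\<^esub>"
      proof -
        obtain y where y: "y \<in> carrier N" "g \<zero>\<^bsub>F\<^esub> = ?q y"
          using g'(2)[of "\<zero>\<^bsub>F\<^esub>"] carrier_quotient_module[OF N H] by auto
        have "g \<zero>\<^bsub>F\<^esub> = g (\<zero>\<^bsub>R\<^esub> \<odot>\<^bsub>F\<^esub> \<zero>\<^bsub>F\<^esub>)" by (simp add: F.smult_l_null)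
        also have "\<dots> = ?q (\<zero>\<^bsub>R\<^esub> \<odot>\<^bsub>N\<^esub> y)" using y by (simp add: g'(4) q(4))
        finally show ?thesis using y by (simp add: N.smult_l_null)
      qed
      have smultS: "r \<odot>\<^bsub>N\<^esub> y \<in> S" if "r \<in> carrier R" "y \<in> S" for r y
        using that by (auto simp: S_def q(4) g'(4)[symmetric])
      have S: "submodule S R N"
      proof (intro submodule.intro subgroup.intro submodule_axioms.intro)
        show "\<one>\<^bsub>add_monoid N\<^esub> \<in> S" using q0 by (auto simp: S_def)
        show "inv\<^bsub>add_monoid N\<^esub> y \<in> S" if "y \<in> S" for y
          using smultS[of "\<ominus>\<^bsub>R\<^esub> \<one>\<^bsub>R\<^esub>" y] that N.smult_minus_one[of y]
          by (simp add: S_def a_inv_def[symmetric])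
      qed (use smultS in \<open>auto simp: S_def q(3) g'(3)[symmetric]\<close>)
      interpret S: additive_subgroup S N
        using S by (simp add: additive_subgroup_def submodule_def)
      have HS: "H \<subseteq> S"
      proof
        fix y assume y: "y \<in> H"
        then have "?q y = ?q \<zero>\<^bsub>N\<^esub>"
          using quotient_map_eq_zero_iff[OF N H] y H.zero_closed H.a_Hcarr[OF y]
          by (metis N.M.zero_closed)
        with q0 have "?q y = g \<zero>\<^bsub>F\<^esub>" by simp
        then have "?q y \<in> g ` carrier F" by (rule image_eqI) simp
        then show "y \<in> S" using H.a_Hcarr[OF y] unfolding S_def by blast
      qed
      have "\<exists>y. y \<in> carrier N \<and> ?q y = g x" if "x \<in> carrier F" for x
        using g'(2)[OF that] carrier_quotient_module[OF N H] by auto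
      then obtain s where s: "\<And>x. x \<in> carrier F \<Longrightarrow> s x \<in> carrier N"
        "\<And>x. x \<in> carrier F \<Longrightarrow> ?q (s x) = g x" by metis
      have sS: "s x \<in> S" if "x \<in> carrier F" for x using s that unfolding S_def by blast
      define c where "c = (\<lambda>y. {(m, v). m \<in> carrier M \<and> v \<in> carrier (free_module R n) \<and>
        y = j m \<oplus>\<^bsub>N\<^esub> s (p v)})"
      have "c y \<noteq> {}" if y: "y \<in> S" for y
      proof -
        obtain x where x: "y \<in> carrier N" "x \<in> carrier F" "?q y = g x" using y unfolding S_def by blast
        then obtain v where v: "v \<in> carrier (free_module R n)" "x = p v" using p(2) by blast
        obtain h where "h \<in> H" "y = h \<oplus>\<^bsub>N\<^esub> s x"
          using quotient_map_eq_iff[OF N H, of "s x" y] s x by auto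
        then show ?thesis using v by (auto simp: c_def H_def)
      qed
      then have c: "inj_on c S" unfolding c_def by (intro inj_onI) blast
      let ?S = "sub_module N S"
      have Sm: "left_module R ?S" by (rule left_module_sub_module[OF N S])
      obtain N' :: "('r, ('m \<times> (nat \<Rightarrow> 'r)) set) module" where N': "left_module R N'"
        "carrier N' = c ` S" "restrict c S \<in> left_module_hom R ?S N'"
        "restrict (inv_into S c) (carrier N') \<in> left_module_hom R N' ?S"
        using left_module_transport[OF Sm, of c] c by auto
      define e where "e = restrict c S"
      define d where "d = restrict (inv_into S c) (carrier N')"
      have e: "e \<in> left_module_hom R ?S N'" "inj_on e S" "e ` S = carrier N'"
        using N' c by (auto simp: e_def)
      have d: "d \<in> left_module_hom R N' ?S" using N' by (simp add: d_def)
      have ed: "e (d z) = z" if "z \<in> carrier N'" for z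
        using that by (auto simp: e_def d_def N'(2) c)
      have jS: "j \<in> left_module_hom R M ?S"
        using HS left_module_homD[OF j(1)] by (intro left_module_homI) (auto simp: H_def)
      define j' where "j' = compose (carrier M) e j"
      define H' where "H' = e ` H"
      have j': "j' \<in> left_module_hom R M N'"
        unfolding j'_def by (rule left_module_hom_compose[OF Mm jS e(1)])
      have "inj_on j' (carrier M)"
        using j(2) e(2) left_module_homD(2)[OF jS]
        by (auto simp: j'_def compose_def inj_on_def)
      moreover have j'H: "j' ` carrier M = H'" by (auto simp: j'_def compose_def H'_def H_def)
      ultimately have pure': "pure_submodule R H' N'"
        using M N'(1) j' unfolding absolutely_pure_def by metis
      then have H': "submodule H' R N'" by (simp add: pure_submodule_def)
      let ?Q' = "quotient_module N' H'" and ?q' = "quotient_map N' H'"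
      note q' = left_module_homD[OF quotient_map_hom[OF N'(1) H']]
      note e' = left_module_homD[OF e(1), simplified]
      have qS: "?q y \<subseteq> S" if "y \<in> S" for y
        using that HS by (auto simp: quotient_map_def a_r_coset_def' S.a_closed)
      have q'e: "?q' (e y) = e ` ?q y" if "y \<in> S" for y
      proof -
        have yN: "y \<in> carrier N" using that S.a_Hcarr by blast
        have "?q' (e y) = (\<lambda>h. e h \<oplus>\<^bsub>N'\<^esub> e y) ` H"
          unfolding quotient_map_def a_r_coset_def' H'_def using e'(2)[OF that] by auto
        also have "\<dots> = (\<lambda>h. e (h \<oplus>\<^bsub>N\<^esub> y)) ` H"
          using e'(3)[OF _ that] HS by (intro image_cong) auto
        also have "\<dots> = e ` ?q y"
          unfolding quotient_map_def a_r_coset_def' using yN by auto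
        finally show ?thesis .
      qed
      define g2 where "g2 = (\<lambda>x\<in>carrier F. e ` g x)"
      have g2: "g2 x = ?q' (e y)" if "x \<in> carrier F" "y \<in> S" "?q y = g x" for x y
        using that q'e by (simp add: g2_def)
      have "g2 \<in> left_module_hom R F ?Q'"
      proof (rule left_module_homI)
        show "g2 \<in> extensional (carrier F)" by (simp add: g2_def)
        show "g2 x \<in> carrier ?Q'" if "x \<in> carrier F" for x
          using g2[OF that sS[OF that] s(2)[OF that]] sS[OF that] e'(2) q'(2) by simp
        show "g2 (x \<oplus>\<^bsub>F\<^esub> y) = g2 x \<oplus>\<^bsub>?Q'\<^esub> g2 y" if x: "x \<in> carrier F" and y: "y \<in> carrier F" for x y
        proof -
          have "g2 (x \<oplus>\<^bsub>F\<^esub> y) = ?q' (e (s x \<oplus>\<^bsub>N\<^esub> s y))"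
            using x y sS s by (intro g2) (auto simp: q(3) g'(3) S.a_closed)
          then show ?thesis
            using x y sS s g2[of x "s x"] g2[of y "s y"] by (simp add: e'(2,3) q'(3))
        qed
        show "g2 (r \<odot>\<^bsub>F\<^esub> x) = r \<odot>\<^bsub>?Q'\<^esub> g2 x" if r: "r \<in> carrier R" and x: "x \<in> carrier F" for r x
        proof -
          have "g2 (r \<odot>\<^bsub>F\<^esub> x) = ?q' (e (r \<odot>\<^bsub>N\<^esub> s x))"
            using r x sS s smultS by (intro g2) (auto simp: q(4) g'(4))
          then show ?thesis
            using r x sS s g2[of x "s x"] by (simp add: e'(2,4) q'(4))
        qed
      qed
      then obtain h where h: "h \<in> left_module_hom R F N'" "compose (carrier F) ?q' h = g2"
        using pure' F hom_exact_iff[OF N'(1) H' Fm] unfolding pure_submodule_def by blast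
      let ?h = "compose (carrier F) d h"
      have hS: "?h \<in> left_module_hom R F ?S" by (rule left_module_hom_compose[OF Fm h(1) d])
      then have hN: "?h \<in> left_module_hom R F N"
        using S.a_subset by (auto simp: left_module_hom_def hom_def)
      have "compose (carrier F) ?q ?h = g"
      proof
        fix x show "compose (carrier F) ?q ?h x = g x"
        proof (cases "x \<in> carrier F")
          case True
          have hx: "?h x \<in> S" using left_module_homD(2)[OF hS True] by simp
          have "e (?h x) = h x" using True left_module_homD(2)[OF h(1) True] ed by (simp add: compose_def)
          then have "e ` ?q (?h x) = e ` g x"
            using q'e[OF hx] fun_cong[OF h(2), of x] True by (simp add: compose_def g2_def)
          moreover have "?q (?h x) \<subseteq> S" "g x \<subseteq> S"
            using qS[OF hx] qS[OF sS[OF True]] s(2)[OF True] by auto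
          ultimately have "?q (?h x) = g x" by (rule inj_on_image_eq_iff[OF e(2), THEN iffD1, rotated 2])
          then show ?thesis using True by (simp add: compose_def)
        next
          case False
          then show ?thesis using g'(1) by (simp add: compose_def extensional_def)
        qed
      qed
      then show "\<exists>h\<in>left_module_hom R F N. compose (carrier F) ?q h = g" using hN by blast
    qed
  qed
  then show ?thesis using H by (simp add: pure_submodule_def H_def)
qed

end

theory Submission
  imports Defs
begin

text \<open>A Boolean ring \<open>R\<close> is coherent, because a finitely generated ideal is generated by one idempotent.
  Every finitely presented \<open>R\<close>-module is projective: one eliminates one generator at a time, using that the
  coefficients of that generator in the relations generate a principal ideal \<open>Re\<close>, where \<open>e\<close> is itself
  a coefficient in a relation. Hence every \<open>R\<close>-module is absolutely pure. If \<open>R\<close> has no atoms, as for the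
  ring of periodic sets of natural numbers, then every nonzero ideal splits, so the regular
  module has no indecomposable submodules at all.\<close>

section \<open>Linear combinations in left modules\<close>

lemma (in left_module) smult_r_null:
  assumes "r \<in> carrier R"
  shows "r \<odot>\<^bsub>M\<^esub> \<zero>\<^bsub>M\<^esub> = \<zero>\<^bsub>M\<^esub>"
  using smult_r_distr[of r "\<zero>\<^bsub>M\<^esub>" "\<zero>\<^bsub>M\<^esub>"] assms
  by (metis M.add.r_cancel_one' M.l_zero M.zero_closed smult_closed)

text \<open>Closure under additive inverses is not asked for: negation is scalar multiplication by
  \<open>\<ominus> \<one>\<close>.\<close>

lemma (in left_module) left_submoduleI:
  assumes "H \<subseteq> carrier M" "\<zero>\<^bsub>M\<^esub> \<in> H"
    and "\<And>x y. x \<in> H \<Longrightarrow> y \<in> H \<Longrightarrow> x \<oplus>\<^bsub>M\<^esub> y \<in> H"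
    and smult: "\<And>r x. r \<in> carrier R \<Longrightarrow> x \<in> H \<Longrightarrow> r \<odot>\<^bsub>M\<^esub> x \<in> H"
  shows "submodule H R M"
proof (intro submodule.intro subgroup.intro submodule_axioms.intro)
  show "inv\<^bsub>add_monoid M\<^esub> x \<in> H" if "x \<in> H" for x
  proof -
    have "(\<ominus> \<one>) \<odot>\<^bsub>M\<^esub> x = \<ominus>\<^bsub>M\<^esub> x" using that assms(1) by (intro smult_minus_one) auto
    with smult[OF R.add.inv_closed[OF R.one_closed] that] show ?thesis by (metis a_inv_def)
  qed
qed (use assms in auto)

lemma left_module_regular_module:
  assumes "ring R"
  shows "left_module R (regular_module R)"
proof -
  interpret ring R by fact
  have "abelian_group (regular_module R)"
    by (rule abelian_groupI)
       (auto simp: regular_module_def a_assoc a_comm a_lcomm intro!: bexI[of _ "\<ominus>\<^bsub>R\<^esub> _"] l_neg)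
  then show ?thesis
    by (intro left_module.intro left_module_axioms.intro)
       (auto simp: regular_module_def ring_axioms l_distr r_distr m_assoc)
qed

lemma left_module_free_module:
  assumes "ring R"
  shows "left_module R (free_module R n)"
proof -
  interpret ring R by fact
  have "abelian_group (free_module R n)"
  proof (rule abelian_groupI)
    show "\<exists>y\<in>carrier (free_module R n). y \<oplus>\<^bsub>free_module R n\<^esub> x = \<zero>\<^bsub>free_module R n\<^esub>"
      if "x \<in> carrier (free_module R n)" for x
      using that by (intro bexI[of _ "\<lambda>i\<in>{..<n}. \<ominus>\<^bsub>R\<^esub> x i"])
        (auto simp: free_module_def PiE_iff l_neg intro!: restrict_ext)
  qed (auto simp: free_module_def PiE_iff a_assoc a_comm a_lcomm extensional_def fun_eq_iff)
  then show ?thesis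
    by (intro left_module.intro left_module_axioms.intro)
       (auto simp: free_module_def PiE_iff ring_axioms l_distr r_distr m_assoc extensional_def
          fun_eq_iff)
qed

text \<open>Every element of the quotient is a value of \<open>quotient_map\<close>, and this map
  respects the operations, so each axiom is pulled back to the same axiom in
  \<open>N\<close>.\<close>

lemma left_module_quotient_module:
  assumes N: "left_module R N" and H: "submodule H R N"
  shows "left_module R (quotient_module N H)"
proof -
  interpret N: left_module R N by fact
  let ?Q = "quotient_module N H" and ?q = "quotient_map N H"
  note hom = quotient_map_hom[OF N H] and carrier = carrier_quotient_module[OF N H]
  have q: "?q x \<oplus>\<^bsub>?Q\<^esub> ?q y = ?q (x \<oplus>\<^bsub>N\<^esub> y)" 
    if "x \<in> carrier N" "y \<in> carrier N" for x y
    using left_module_homD(3)[OF hom] that by simp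
  have q': "r \<odot>\<^bsub>?Q\<^esub> ?q x = ?q (r \<odot>\<^bsub>N\<^esub> x)" if "r \<in> carrier R" "x \<in> carrier N" for r x
    using left_module_homD(4)[OF hom] that by simp
  have zero: "\<zero>\<^bsub>?Q\<^esub> = ?q \<zero>\<^bsub>N\<^esub>"
    using quotient_map_eq_zero_iff[OF N H N.M.zero_closed] H subgroup.one_closed[of H "add_monoid N"]
    by (simp add: submodule_def)
  have "abelian_group ?Q"
  proof (rule abelian_groupI)
    show "\<exists>y\<in>carrier ?Q. y \<oplus>\<^bsub>?Q\<^esub> x = \<zero>\<^bsub>?Q\<^esub>" if "x \<in> carrier ?Q" for x
      using that by (auto simp: carrier zero q N.M.l_neg intro!: bexI[of _ "\<ominus>\<^bsub>N\<^esub> _"])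
  qed (auto simp: carrier zero q N.M.a_assoc N.M.a_comm N.M.a_lcomm)
  then show ?thesis
    by (intro left_module.intro left_module_axioms.intro)
       (auto simp: carrier q q' N.R.ring_axioms N.smult_l_distr N.smult_r_distr N.smult_assoc1)
qed

text \<open>Recursion on the length lets an induction split off the last generator. Only the values
  below the length are read, so vectors need not be extensional.\<close>

primrec lin_comb :: "('r, 'm) module \<Rightarrow> (nat \<Rightarrow> 'm) \<Rightarrow> (nat \<Rightarrow> 'r) \<Rightarrow> nat \<Rightarrow> 'm"
  where "lin_comb M y v 0 = \<zero>\<^bsub>M\<^esub>"
  | "lin_comb M y v (Suc n) = lin_comb M y v n \<oplus>\<^bsub>M\<^esub> v n \<odot>\<^bsub>M\<^esub> y n"

lemma lin_comb_cong:
  assumes "\<And>i. i < n \<Longrightarrow> x i = y i" "\<And>i. i < n \<Longrightarrow> v i = w i"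
  shows "lin_comb M x v n = lin_comb M y w n"
  using assms by (induction n) auto

context left_module
begin

lemma lin_comb_closed:
  assumes "y \<in> {..<n} \<rightarrow> carrier M" "v \<in> {..<n} \<rightarrow> carrier R"
  shows "lin_comb M y v n \<in> carrier M"
  using assms by (induction n) (auto simp: Pi_iff)

lemma lin_comb_add:
  assumes "y \<in> {..<n} \<rightarrow> carrier M" "v \<in> {..<n} \<rightarrow> carrier R" "w \<in> {..<n} \<rightarrow> carrier R"
  shows "lin_comb M y (\<lambda>i. v i \<oplus> w i) n = lin_comb M y v n \<oplus>\<^bsub>M\<^esub> lin_comb M y w n"
  using assms
proof (induction n)
  case (Suc n)
  then have "lin_comb M y v n \<in> carrier M" "lin_comb M y w n \<in> carrier M"
    by (auto simp: Pi_iff intro!: lin_comb_closed)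
  moreover have "v n \<in> carrier R" "w n \<in> carrier R" "y n \<in> carrier M" using Suc.prems by auto
  moreover have "lin_comb M y (\<lambda>i. v i \<oplus> w i) n = lin_comb M y v n \<oplus>\<^bsub>M\<^esub> lin_comb M y w n"
    using Suc by (simp add: Pi_iff)
  ultimately show ?case by (simp add: smult_l_distr M.add.m_ac)
qed simp

lemma lin_comb_smult:
  assumes "y \<in> {..<n} \<rightarrow> carrier M" "v \<in> {..<n} \<rightarrow> carrier R" "r \<in> carrier R"
  shows "lin_comb M y (\<lambda>i. r \<otimes> v i) n = r \<odot>\<^bsub>M\<^esub> lin_comb M y v n"
  using assms
proof (induction n)
  case (Suc n)
  then have "lin_comb M y v n \<in> carrier M" by (auto simp: Pi_iff intro!: lin_comb_closed)
  moreover have "v n \<in> carrier R" "y n \<in> carrier M" using Suc.prems by auto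
  moreover have "lin_comb M y (\<lambda>i. r \<otimes> v i) n = r \<odot>\<^bsub>M\<^esub> lin_comb M y v n"
    using Suc by (simp add: Pi_iff)
  ultimately show ?case using Suc.prems(3) by (simp add: smult_r_distr smult_assoc1)
qed (simp add: smult_r_null)

lemma hom_lin_comb:
  assumes N: "left_module R N" and f: "f \<in> left_module_hom R M N"
    and "y \<in> {..<n} \<rightarrow> carrier M" "v \<in> {..<n} \<rightarrow> carrier R"
  shows "f (lin_comb M y v n) = lin_comb N (f \<circ> y) v n"
  using assms(3,4)
proof (induction n)
  case 0
  then show ?case by (simp add: left_module_hom_zero[OF left_module_axioms N f])
next
  case (Suc n)
  then have "lin_comb M y v n \<in> carrier M" by (auto simp: Pi_iff intro!: lin_comb_closed)
  moreover have "v n \<in> carrier R" "y n \<in> carrier M" using Suc.prems by auto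
  moreover have "f (lin_comb M y v n) = lin_comb N (f \<circ> y) v n" using Suc by (simp add: Pi_iff comp_def)
  ultimately show ?case by (simp add: left_module_homD[OF f] comp_def)
qed

end

text \<open>Turns a homomorphism on a free module into coordinates: it is determined by its values
  on the standard basis. The induction runs over the truncations \<open>t m\<close> of
  \<open>v\<close> to its first \<open>m\<close> entries.\<close>

lemma free_module_hom_eq_lin_comb:
  assumes R: "ring R" and F: "left_module R F" and p: "p \<in> left_module_hom R (free_module R n) F"
    and v: "v \<in> carrier (free_module R n)"
  shows "p v = lin_comb F (\<lambda>j. p (\<lambda>i\<in>{..<n}. if i = j then \<one>\<^bsub>R\<^esub> else \<zero>\<^bsub>R\<^esub>)) v n"
proof -
  interpret F: left_module R F by fact
  let ?E = "free_module R n"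
  define b where "b = (\<lambda>j. \<lambda>i\<in>{..<n}. if i = j then \<one>\<^bsub>R\<^esub> else \<zero>\<^bsub>R\<^esub>)"
  define t where "t = (\<lambda>m. \<lambda>i\<in>{..<n}. if i < m then v i else \<zero>\<^bsub>R\<^esub>)"
  have vR: "v i \<in> carrier R" if "i < n" for i using v that by (auto simp: free_module_def)
  have b: "b j \<in> carrier ?E" for j by (auto simp: free_module_def b_def)
  have t: "t m \<in> carrier ?E" for m using vR by (auto simp: free_module_def t_def)
  have *: "p (t m) = lin_comb F (\<lambda>j. p (b j)) v m" if "m \<le> n" for m
    using that
  proof (induction m)
    case 0
    have "t 0 = \<zero>\<^bsub>?E\<^esub>" by (simp add: free_module_def t_def)
    then show ?case using left_module_hom_zero[OF left_module_free_module[OF R] F p] by simp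
  next
    case (Suc m)
    have "t (Suc m) = t m \<oplus>\<^bsub>?E\<^esub> v m \<odot>\<^bsub>?E\<^esub> b m"
      using Suc.prems vR by (auto simp: free_module_def t_def b_def less_Suc_eq fun_eq_iff)
    moreover have "v m \<odot>\<^bsub>?E\<^esub> b m \<in> carrier ?E"
      using Suc.prems vR by (auto simp: free_module_def b_def)
    ultimately show ?case
      using Suc t b[of m] vR[of m] by (simp add: left_module_homD(3,4)[OF p])
  qed
  have "t n = v" using v by (auto simp: free_module_def t_def fun_eq_iff PiE_iff extensional_def)
  with *[of n] show ?thesis by (simp add: b_def)
qed


section \<open>Rings of sets\<close>

text \<open>For a field of sets this is a Boolean ring: every element is idempotent and is its own
  negative, and the complement of \<open>e\<close> is \<open>1 - e\<close>.\<close>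

definition set_ring :: "'a set set \<Rightarrow> 'a set ring"
  where "set_ring \<A> = \<lparr>carrier = \<A>, mult = (\<inter>), one = UNIV, zero = {}, add = sym_diff\<rparr>"

lemma set_ring_simps [simp]:
  "carrier (set_ring \<A>) = \<A>" "A \<otimes>\<^bsub>set_ring \<A>\<^esub> B = A \<inter> B" "\<one>\<^bsub>set_ring \<A>\<^esub> = UNIV"
  "\<zero>\<^bsub>set_ring \<A>\<^esub> = {}" "A \<oplus>\<^bsub>set_ring \<A>\<^esub> B = sym_diff A B"
  by (simp_all add: set_ring_def)

lemma regular_module_set_ring_simps [simp]:
  "carrier (regular_module (set_ring \<A>)) = \<A>" "\<zero>\<^bsub>regular_module (set_ring \<A>)\<^esub> = {}"
  "A \<oplus>\<^bsub>regular_module (set_ring \<A>)\<^esub> B = sym_diff A B"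
  "A \<odot>\<^bsub>regular_module (set_ring \<A>)\<^esub> B = A \<inter> B"
  by (simp_all add: regular_module_def set_ring_def)

text \<open>Commutativity of intersection; through this equation right coherence becomes left
  coherence.\<close>

lemma opposite_set_ring: "opposite_ring (set_ring \<A>) = set_ring \<A>"
  by (simp add: opposite_ring_def set_ring_def Int_commute)

locale field_of_sets =
  fixes \<A> :: "'a set set"
  assumes UNIV_mem [simp]: "UNIV \<in> \<A>"
    and Int_mem [simp]: "A \<in> \<A> \<Longrightarrow> B \<in> \<A> \<Longrightarrow> A \<inter> B \<in> \<A>"
    and Compl_mem [simp]: "A \<in> \<A> \<Longrightarrow> - A \<in> \<A>"
begin

lemma Diff_mem [simp]: "A \<in> \<A> \<Longrightarrow> B \<in> \<A> \<Longrightarrow> A - B \<in> \<A>"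
  by (simp add: Diff_eq)

lemma empty_mem [simp]: "{} \<in> \<A>"
  using Compl_mem[OF UNIV_mem] by simp

lemma Un_mem [simp]:
  assumes "A \<in> \<A>" "B \<in> \<A>"
  shows "A \<union> B \<in> \<A>"
proof -
  have "A \<union> B = - (- A \<inter> - B)" by simp
  then show ?thesis using assms by (metis Int_mem Compl_mem)
qed

lemma ring_set_ring: "ring (set_ring \<A>)"
proof (rule ringI)
  show "abelian_group (set_ring \<A>)"
    by (rule abelian_groupI) auto
  show "monoid (set_ring \<A>)"
    by (rule monoidI) auto
qed auto

section \<open>Projectivity of finitely presented modules\<close>

text \<open>Projectivity in coordinates: finitely many relations among elements of \<open>Q\<close>
  can be lifted together with the elements. By induction on the number of generators, one relation
  \<open>k\<close> is used to clear the last coefficient of all the others; the shorter relations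
  are lifted first, and then the lift of the last generator is corrected to satisfy
  \<open>k\<close>.\<close>

lemma lift_relations:
  assumes N: "left_module (set_ring \<A>) N" and Q: "left_module (set_ring \<A>) Q"
    and q: "q \<in> left_module_hom (set_ring \<A>) N Q" "q ` carrier N = carrier Q"
    and "finite A" "A \<subseteq> {..<n} \<rightarrow> \<A>" "y \<in> {..<n} \<rightarrow> carrier Q"
    and "\<And>a. a \<in> A \<Longrightarrow> lin_comb Q y a n = \<zero>\<^bsub>Q\<^esub>"
  shows "\<exists>x \<in> {..<n} \<rightarrow> carrier N. (\<forall>i<n. q (x i) = y i) \<and> (\<forall>a\<in>A. lin_comb N x a n = \<zero>\<^bsub>N\<^esub>)"
  using assms(5-)
proof (induction n arbitrary: A)
  case 0
  then show ?case by auto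
next
  case (Suc n)
  interpret N: left_module "set_ring \<A>" N by fact
  interpret Q: left_module "set_ring \<A>" Q by fact
  note A = Suc.prems
  have yn: "y n \<in> carrier Q" using A(3) by auto
  have mono: "w \<in> {..<Suc n} \<rightarrow> X \<Longrightarrow> w \<in> {..<n} \<rightarrow> X" for w :: "nat \<Rightarrow> 'x" and X by auto
  note Qadd = Q.lin_comb_add[simplified] and Qsmult = Q.lin_comb_smult[simplified]
  note Nadd = N.lin_comb_add[simplified] and Nsmult = N.lin_comb_smult[simplified]
  \<comment> \<open>The pivot: a relation whose last coefficient contains that of every member of
    \<open>A\<close>. It is built up one relation at a time.\<close>
  have "\<exists>k \<in> {..<Suc n} \<rightarrow> \<A>. lin_comb Q y k (Suc n) = \<zero>\<^bsub>Q\<^esub> \<and> (\<forall>a\<in>A. a n \<subseteq> k n)"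
    using A(1,2,4)
  proof (induction A rule: finite_induct)
    case empty
    have "lin_comb Q y (\<lambda>_. {}) (Suc n) = {} \<odot>\<^bsub>Q\<^esub> lin_comb Q y (\<lambda>_. {}) (Suc n)"
      using Qsmult[OF A(3), of "\<lambda>_. {}" "{}"] by simp
    also have "\<dots> = \<zero>\<^bsub>Q\<^esub>"
      using Q.smult_l_null[OF Q.lin_comb_closed[OF A(3)], of "\<lambda>_. {}"] by simp
    finally show ?case by (intro bexI[of _ "\<lambda>_. {}"]) auto
  next
    case (insert a A)
    then obtain k where k: "k \<in> {..<Suc n} \<rightarrow> \<A>" "lin_comb Q y k (Suc n) = \<zero>\<^bsub>Q\<^esub>"
      "\<forall>a\<in>A. a n \<subseteq> k n" by auto
    have a: "a \<in> {..<Suc n} \<rightarrow> \<A>" "lin_comb Q y a (Suc n) = \<zero>\<^bsub>Q\<^esub>" using insert.prems by auto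
    have kn: "- k n \<in> \<A>" using k(1) by (simp add: Pi_iff)
    \<comment> \<open>Multiplying \<open>a\<close> by the complement of \<open>k n\<close> makes the
      last coefficients disjoint, so that their sum is the union of \<open>k n\<close> and
      \<open>a n\<close>.\<close>
    let ?b = "\<lambda>i. - k n \<inter> a i"
    let ?k = "\<lambda>i. sym_diff (k i) (?b i)"
    have b: "?b \<in> {..<Suc n} \<rightarrow> \<A>" using a(1) kn by (intro Pi_I Int_mem) auto
    have "lin_comb Q y ?k (Suc n) = \<zero>\<^bsub>Q\<^esub>"
      unfolding Qadd[OF A(3) k(1) b] Qsmult[OF A(3) a(1) kn] k(2) a(2)
      using kn by (simp add: Q.smult_r_null)
    moreover have "?k \<in> {..<Suc n} \<rightarrow> \<A>" using k(1) b by (intro Pi_I Un_mem Diff_mem) auto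
    moreover have "\<forall>a\<in>insert a A. a n \<subseteq> ?k n" using k(3) by auto
    ultimately show ?case by blast
  qed
  then obtain k0 where k0: "k0 \<in> {..<Suc n} \<rightarrow> \<A>" "lin_comb Q y k0 (Suc n) = \<zero>\<^bsub>Q\<^esub>"
    "\<And>a. a \<in> A \<Longrightarrow> a n \<subseteq> k0 n" by auto
  define e where "e = k0 n"
  \<comment> \<open>Multiplication by \<open>e\<close> keeps the last coefficient and puts all the
    others below \<open>e\<close>; this is what later gives that \<open>e\<close> fixes the defect
    \<open>z\<close>.\<close>
  define k where "k = (\<lambda>i. e \<inter> k0 i)"
  have e: "e \<in> \<A>" "k n = e" "\<And>i. e \<inter> k i = k i" using k0(1) by (auto simp: e_def k_def)
  have k: "k \<in> {..<Suc n} \<rightarrow> \<A>" using k0(1) e(1) by (auto simp: k_def Pi_iff)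
  have kQ: "lin_comb Q y k (Suc n) = \<zero>\<^bsub>Q\<^esub>"
    unfolding k_def Qsmult[OF A(3) k0(1) e(1)] k0(2) using e(1) by (simp add: Q.smult_r_null)
  \<comment> \<open>Elimination: \<open>r a\<close> is \<open>a\<close> minus \<open>a n\<close>
    times \<open>k\<close>. Its last coefficient vanishes because \<open>a n\<close> lies below
    \<open>e\<close>, so it is a relation among the first \<open>n\<close> generators.\<close>
  define r where "r = (\<lambda>a i. sym_diff (a i) (a n \<inter> k i))"
  have rn: "r a n = {}" if "a \<in> A" for a using k0(3)[OF that] e(2) by (auto simp: r_def e_def)
  have an: "a n \<in> \<A>" "(\<lambda>i. a n \<inter> k i) \<in> {..<Suc n} \<rightarrow> \<A>" if "a \<in> A" for a
    using that A(2) k by (auto simp: Pi_iff subset_iff)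
  have r: "r a \<in> {..<Suc n} \<rightarrow> \<A>" if "a \<in> A" for a
    using that A(2) an[OF that] unfolding r_def by (intro Pi_I Un_mem Diff_mem) auto
  have rQ: "lin_comb Q y (r a) n = \<zero>\<^bsub>Q\<^esub>" if a: "a \<in> A" for a
  proof -
    have aA: "a \<in> {..<Suc n} \<rightarrow> \<A>" using a A(2) by auto
    have "lin_comb Q y (r a) (Suc n) = \<zero>\<^bsub>Q\<^esub>"
      unfolding r_def Qadd[OF A(3) aA an(2)[OF a]] Qsmult[OF A(3) k an(1)[OF a]] kQ A(4)[OF a]
      using an[OF a] by (simp add: Q.smult_r_null)
    moreover have "lin_comb Q y (r a) n \<in> carrier Q"
      using Q.lin_comb_closed[of y n "r a"] mono[OF A(3)] mono[OF r[OF a]] by simp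
    ultimately show ?thesis using Q.smult_l_null[OF yn] by (simp add: rn[OF a])
  qed
  have "\<exists>x \<in> {..<n} \<rightarrow> carrier N. (\<forall>i<n. q (x i) = y i) \<and> (\<forall>a\<in>r ` A. lin_comb N x a n = \<zero>\<^bsub>N\<^esub>)"
    using A(1) mono[OF A(3)] mono[OF r] rQ by (intro Suc.IH) auto
  then obtain x where x: "x \<in> {..<n} \<rightarrow> carrier N" "\<And>i. i < n \<Longrightarrow> q (x i) = y i"
    "\<And>a. a \<in> A \<Longrightarrow> lin_comb N x (r a) n = \<zero>\<^bsub>N\<^esub>" by auto
  obtain u where u: "u \<in> carrier N" "q u = y n" using yn q(2) by (metis imageE)
  define xu where "xu = x(n := u)"
  define z where "z = lin_comb N xu k (Suc n)"
  \<comment> \<open>\<open>z\<close> is the defect of the relation \<open>k\<close>; as \<open>e z = z\<close> and \<open>z + z = 0\<close>, adding it to \<open>u\<close> removes it.\<close>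
  define x' where "x' = x(n := u \<oplus>\<^bsub>N\<^esub> z)"
  have xu: "xu \<in> {..<Suc n} \<rightarrow> carrier N" using x(1) u(1) by (auto simp: xu_def less_Suc_eq)
  have z: "z \<in> carrier N" unfolding z_def using xu k by (intro N.lin_comb_closed) auto
  have x': "x' \<in> {..<Suc n} \<rightarrow> carrier N" using x(1) u(1) z by (auto simp: x'_def less_Suc_eq)
  have "q z = lin_comb Q (q \<circ> xu) k (Suc n)"
    unfolding z_def using xu k by (intro N.hom_lin_comb[OF Q q(1)]) auto
  also have "\<dots> = \<zero>\<^bsub>Q\<^esub>" unfolding kQ[symmetric]
    by (rule lin_comb_cong) (use x(2) u(2) in \<open>auto simp: xu_def less_Suc_eq\<close>)
  finally have qz: "q z = \<zero>\<^bsub>Q\<^esub>" .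
  have ez: "e \<odot>\<^bsub>N\<^esub> z = z" unfolding z_def using Nsmult[OF xu k e(1), unfolded e(3)] by (rule sym)
  \<comment> \<open>In the ring, \<open>UNIV\<close> plus \<open>UNIV\<close> is the empty set, so
    every module has characteristic two.\<close>
  have zz: "z \<oplus>\<^bsub>N\<^esub> z = \<zero>\<^bsub>N\<^esub>"
    using N.smult_l_distr[of UNIV UNIV z] N.smult_l_null[OF z] N.smult_one[OF z] z by simp
  have xx: "lin_comb N x' w n = lin_comb N x w n" "lin_comb N xu w n = lin_comb N x w n" for w
    by (rule lin_comb_cong; simp add: x'_def xu_def)+
  have xk: "lin_comb N x k n \<in> carrier N" using N.lin_comb_closed[OF x(1)] mono[OF k] by simp
  have "lin_comb N x' k (Suc n) = lin_comb N x k n \<oplus>\<^bsub>N\<^esub> (e \<odot>\<^bsub>N\<^esub> u \<oplus>\<^bsub>N\<^esub> z)"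
    using N.smult_r_distr[of e u z] e(1) u(1) z by (simp add: xx e(2) ez) (simp add: x'_def ez)
  also have "\<dots> = z \<oplus>\<^bsub>N\<^esub> z"
    unfolding z_def using e(1) u(1) z xk N.smult_closed[of e u]
    by (simp add: xx e(2) N.M.a_assoc) (simp add: z_def xu_def xx e(2) N.M.a_assoc)
  finally have x'k: "lin_comb N x' k (Suc n) = \<zero>\<^bsub>N\<^esub>" by (simp only: zz)
  have "lin_comb N x' a (Suc n) = \<zero>\<^bsub>N\<^esub>" if a: "a \<in> A" for a
  proof -
    \<comment> \<open>The elimination is undone. Both summands vanish on \<open>x'\<close>:
      \<open>k\<close> by the correction, and \<open>r a\<close> because its last coefficient is
      empty, so that the change of the last generator is invisible to it.\<close>
    have "a = (\<lambda>i. sym_diff (r a i) (a n \<inter> k i))" by (auto simp: r_def)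
    then have "lin_comb N x' a (Suc n) = lin_comb N x' (\<lambda>i. sym_diff (r a i) (a n \<inter> k i)) (Suc n)"
      by (rule arg_cong)
    also have "\<dots> = lin_comb N x' (r a) (Suc n) \<oplus>\<^bsub>N\<^esub> a n \<odot>\<^bsub>N\<^esub> lin_comb N x' k (Suc n)"
      unfolding Nadd[OF x' r[OF a] an(2)[OF a]] Nsmult[OF x' k an(1)[OF a]] ..
    also have "\<dots> = lin_comb N x' (r a) (Suc n)"
      unfolding x'k using an(1)[OF a] N.lin_comb_closed[OF x', of "r a"] r[OF a]
      by (simp add: N.smult_r_null del: lin_comb.simps)
    also have "\<dots> = \<zero>\<^bsub>N\<^esub>"
      using x' N.smult_l_null[of "x' n"] by (simp add: Pi_iff xx x(3)[OF a] rn[OF a])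
    finally show ?thesis .
  qed
  moreover have "q (x' i) = y i" if "i < Suc n" for i
    using that x(2) u z qz yn by (auto simp: x'_def less_Suc_eq left_module_homD(3)[OF q(1)])
  ultimately show ?case using x' by blast
qed

text \<open>The images of the basis vectors under \<open>g\<close> after \<open>p\<close> are lifted
  to \<open>N\<close> so that the finitely many generators of the kernel \<open>K\<close> stay
  relations. The resulting linear map on the free module then kills \<open>K\<close> and factors
  through \<open>p\<close>.\<close>

lemma finitely_presented_projective:
  assumes F: "finitely_presented (set_ring \<A>) F"
    and N: "left_module (set_ring \<A>) N" and Q: "left_module (set_ring \<A>) Q"
    and q: "q \<in> left_module_hom (set_ring \<A>) N Q" "q ` carrier N = carrier Q"
    and g: "g \<in> left_module_hom (set_ring \<A>) F Q"
  shows "\<exists>h \<in> left_module_hom (set_ring \<A>) F N. compose (carrier F) q h = g"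
proof -
  let ?R = "set_ring \<A>"
  note R = ring_set_ring
  have Fm: "left_module ?R F" using F by (simp add: finitely_presented_def)
  interpret F: left_module ?R F by fact
  interpret N: left_module ?R N by fact
  obtain n p where p: "p \<in> left_module_hom ?R (free_module ?R n) F"
      "p ` carrier (free_module ?R n) = carrier F"
    and "finitely_generated ?R (sub_module (free_module ?R n) (a_kernel (free_module ?R n) F p))"
    using F by (auto simp: finitely_presented_def)
  let ?E = "free_module ?R n"
  define K where "K = a_kernel ?E F p"
  obtain A where A: "finite A" "A \<subseteq> K" "\<And>H. submodule H ?R (sub_module ?E K) \<Longrightarrow> A \<subseteq> H \<Longrightarrow> H = K"
    using \<open>finitely_generated _ _\<close> by (auto simp: finitely_generated_def K_def)
  have E: "left_module ?R ?E" by (rule left_module_free_module[OF R])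
  interpret E: left_module ?R ?E by (rule E)
  note p' = left_module_homD[OF p(1)] and g' = left_module_homD[OF g]
  have K: "v \<in> K \<longleftrightarrow> v \<in> carrier ?E \<and> p v = \<zero>\<^bsub>F\<^esub>" for v by (auto simp: K_def a_kernel_def')
  have Ks: "submodule K ?R ?E"
    by (rule E.left_submoduleI)
       (auto simp: K p' left_module_hom_zero[OF E Fm p(1)] F.smult_r_null[simplified])
  interpret K: left_module ?R "sub_module ?E K" by (rule left_module_sub_module[OF E Ks])
  define b :: "nat \<Rightarrow> nat \<Rightarrow> 'a set" where "b = (\<lambda>j. \<lambda>i\<in>{..<n}. if i = j then UNIV else {})"
  have b: "b j \<in> carrier ?E" for j by (auto simp: free_module_def b_def)
  define y where "y = (\<lambda>j. g (p (b j)))"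
  have y: "y \<in> {..<n} \<rightarrow> carrier Q" using g'(2) p'(2) b by (auto simp: y_def)
  have carr: "v \<in> {..<n} \<rightarrow> \<A>" if "v \<in> carrier ?E" for v using that by (auto simp: free_module_def)
  \<comment> \<open>In these coordinates an element of \<open>K\<close> is a relation among the
    \<open>y j\<close>.\<close>
  have gp: "g (p v) = lin_comb Q y v n" if "v \<in> carrier ?E" for v
  proof -
    have "p v = lin_comb F (\<lambda>j. p (b j)) v n"
      using free_module_hom_eq_lin_comb[OF R Fm p(1) that] by (simp add: b_def cong del: if_weak_cong)
    then have "g (p v) = lin_comb Q (g \<circ> (\<lambda>j. p (b j))) v n"
      using F.hom_lin_comb[OF Q g, of "\<lambda>j. p (b j)" n v] p'(2)[OF b] carr[OF that] by simp
    then show ?thesis by (simp add: y_def comp_def)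
  qed
  have "\<exists>x \<in> {..<n} \<rightarrow> carrier N. (\<forall>i<n. q (x i) = y i) \<and> (\<forall>a\<in>A. lin_comb N x a n = \<zero>\<^bsub>N\<^esub>)"
  proof (rule lift_relations[OF N Q q A(1) _ y])
    show "A \<subseteq> {..<n} \<rightarrow> \<A>" using A(2) K carr by blast
    show "lin_comb Q y a n = \<zero>\<^bsub>Q\<^esub>" if "a \<in> A" for a
      using that A(2) K gp left_module_hom_zero[OF Fm Q g] by (metis subsetD)
  qed
  then obtain x where x: "x \<in> {..<n} \<rightarrow> carrier N" "\<And>i. i < n \<Longrightarrow> q (x i) = y i"
    "\<And>a. a \<in> A \<Longrightarrow> lin_comb N x a n = \<zero>\<^bsub>N\<^esub>" by auto
  \<comment> \<open>The linear map from \<open>?E\<close> to \<open>N\<close> that sends the basis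
    vector \<open>b j\<close> to \<open>x j\<close>.\<close>
  define l where "l = (\<lambda>v. lin_comb N x v n)"
  have l_closed: "l v \<in> carrier N" if "v \<in> carrier ?E" for v
    unfolding l_def using x(1) carr[OF that] by (intro N.lin_comb_closed) auto
  have l_add: "l (v \<oplus>\<^bsub>?E\<^esub> w) = l v \<oplus>\<^bsub>N\<^esub> l w" if "v \<in> carrier ?E" "w \<in> carrier ?E" for v w
    unfolding l_def N.lin_comb_add[OF x(1), symmetric, simplified, OF carr[OF that(1)] carr[OF that(2)]]
    by (rule lin_comb_cong) (auto simp: free_module_def)
  have l_smult: "l (r \<odot>\<^bsub>?E\<^esub> v) = r \<odot>\<^bsub>N\<^esub> l v" if "r \<in> \<A>" "v \<in> carrier ?E" for r v
    unfolding l_def N.lin_comb_smult[OF x(1), symmetric, simplified, OF carr[OF that(2)] that(1)]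
    by (rule lin_comb_cong) (auto simp: free_module_def)
  have l_hom: "restrict l (carrier ?E) \<in> left_module_hom ?R ?E N"
    by (rule left_module_homI) (use l_closed l_add l_smult in auto)
  have l_zero: "l \<zero>\<^bsub>?E\<^esub> = \<zero>\<^bsub>N\<^esub>" using left_module_hom_zero[OF E N l_hom] by simp
  \<comment> \<open>Finite generation of \<open>K\<close> enters here: this submodule contains the
    generators \<open>A\<close>, hence is all of \<open>K\<close>.\<close>
  have "submodule {v \<in> K. l v = \<zero>\<^bsub>N\<^esub>} ?R (sub_module ?E K)"
  proof (rule K.left_submoduleI)
    fix v w assume "v \<in> {v \<in> K. l v = \<zero>\<^bsub>N\<^esub>}" "w \<in> {v \<in> K. l v = \<zero>\<^bsub>N\<^esub>}"
    then show "v \<oplus>\<^bsub>sub_module ?E K\<^esub> w \<in> {v \<in> K. l v = \<zero>\<^bsub>N\<^esub>}"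
      using l_add[of v w] K p' by auto
  next
    fix r v assume "r \<in> carrier ?R" "v \<in> {v \<in> K. l v = \<zero>\<^bsub>N\<^esub>}"
    then show "r \<odot>\<^bsub>sub_module ?E K\<^esub> v \<in> {v \<in> K. l v = \<zero>\<^bsub>N\<^esub>}"
      using l_smult[of r v] K p' by (auto simp: F.smult_r_null[simplified] N.smult_r_null[simplified])
  qed (use l_zero K left_module_hom_zero[OF E Fm p(1)] in auto)
  then have "{v \<in> K. l v = \<zero>\<^bsub>N\<^esub>} = K"
    by (rule A(3)) (use A(2) x(3) in \<open>auto simp: l_def\<close>)
  then have lK: "l v = \<zero>\<^bsub>N\<^esub>" if "v \<in> K" for v using that by blast
  have l_eq: "l v = l w" if vw: "v \<in> carrier ?E" "w \<in> carrier ?E" "p v = p w" for v w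
  proof -
    define d where "d = v \<ominus>\<^bsub>?E\<^esub> w"
    have d: "d \<in> carrier ?E" "v = d \<oplus>\<^bsub>?E\<^esub> w"
      using vw by (auto simp: d_def a_minus_def E.M.a_assoc E.M.l_neg)
    then have "p d \<oplus>\<^bsub>F\<^esub> p w = p w" using p'(3)[OF d(1) vw(2)] vw(3) by metis
    then have "p d = \<zero>\<^bsub>F\<^esub>" 
      using p'(2)[OF d(1)] p'(2)[OF vw(2)] by simp
    then have "l d = \<zero>\<^bsub>N\<^esub>" using d(1) by (intro lK) (simp add: K)
    then show ?thesis using l_add[OF d(1) vw(2)] l_closed[OF vw(2)] by (simp flip: d(2))
  qed
  have "\<exists>v. v \<in> carrier ?E \<and> p v = f" if "f \<in> carrier F" for f
    using that p(2) by (metis imageE)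
  \<comment> \<open>A mere choice of preimages under \<open>p\<close>, not a homomorphism;
    \<open>l_eq\<close> shows that \<open>h\<close> does not depend on it.\<close>
  then obtain s where s: "\<And>f. f \<in> carrier F \<Longrightarrow> s f \<in> carrier ?E"
    "\<And>f. f \<in> carrier F \<Longrightarrow> p (s f) = f" by metis
  define h where "h = (\<lambda>f\<in>carrier F. l (s f))"
  have h: "h (p v) = l v" if v: "v \<in> carrier ?E" for v
    using l_eq[OF s(1)[OF p'(2)[OF v]] v s(2)[OF p'(2)[OF v]]] p'(2)[OF v] by (simp add: h_def)
  have "h \<in> left_module_hom ?R F N"
  proof (rule left_module_homI)
    show "h f \<in> carrier N" if "f \<in> carrier F" for f using that s l_closed by (simp add: h_def)
    show "h (f \<oplus>\<^bsub>F\<^esub> f') = h f \<oplus>\<^bsub>N\<^esub> h f'" if f: "f \<in> carrier F" "f' \<in> carrier F" for f f'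
    proof -
      obtain v where v: "v \<in> carrier ?E" "f = p v"
        using s(1)[OF f(1)] s(2)[OF f(1), symmetric] by blast
      obtain w where w: "w \<in> carrier ?E" "f' = p w"
        using s(1)[OF f(2)] s(2)[OF f(2), symmetric] by blast
      have "h (p (v \<oplus>\<^bsub>?E\<^esub> w)) = h (p v) \<oplus>\<^bsub>N\<^esub> h (p w)"
        using v(1) w(1) by (simp add: h l_add)
      then show ?thesis unfolding v(2) w(2) p'(3)[OF v(1) w(1)] .
    qed
    show "h (r \<odot>\<^bsub>F\<^esub> f) = r \<odot>\<^bsub>N\<^esub> h f" if r: "r \<in> carrier ?R" and f: "f \<in> carrier F" for r f
    proof -
      obtain v where v: "v \<in> carrier ?E" "f = p v"
        using s(1)[OF f] s(2)[OF f, symmetric] by blast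
      have "h (p (r \<odot>\<^bsub>?E\<^esub> v)) = r \<odot>\<^bsub>N\<^esub> h (p v)"
        using v(1) r E.smult_closed[OF r v(1)] by (simp add: h l_smult)
      then show ?thesis unfolding v(2) p'(4)[OF r v(1)] .
    qed
  qed (simp add: h_def)
  moreover have "compose (carrier F) q h = g"
  proof
    fix f show "compose (carrier F) q h f = g f"
    proof (cases "f \<in> carrier F")
      case True
      have "q (h f) = lin_comb Q (q \<circ> x) (s f) n"
        using True s carr x(1) by (simp add: h_def l_def N.hom_lin_comb[OF Q q(1)])
      also have "\<dots> = lin_comb Q y (s f) n" by (rule lin_comb_cong) (simp_all add: x(2))
      also have "\<dots> = g f" using gp[of "s f"] True s by simp
      finally show ?thesis using True by (simp add: compose_def)
    next
      case False
      then show ?thesis using g'(1) by (simp add: compose_def extensional_def)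
    qed
  qed
  ultimately show ?thesis by blast
qed

text \<open>By \<open>hom_exact_iff\<close>, exactness amounts to lifting homomorphisms along the
  quotient map, which projectivity of \<open>F\<close> provides.\<close>

lemma absolutely_pure_module:
  assumes M: "left_module (set_ring \<A>) M"
  shows "absolutely_pure (set_ring \<A>) M"
  unfolding absolutely_pure_def pure_submodule_def
proof (intro conjI allI ballI impI)
  fix N j assume N: "left_module (set_ring \<A>) N" and j: "j \<in> left_module_hom (set_ring \<A>) M N"
  show H: "submodule (j ` carrier M) (set_ring \<A>) N"
    by (rule image_left_module_hom_submodule[OF M N j])
  fix F assume F: "finitely_presented (set_ring \<A>) F"
  then have Fm: "left_module (set_ring \<A>) F" by (simp add: finitely_presented_def)
  show "hom_exact (set_ring \<A>) F (j ` carrier M) N"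
    unfolding hom_exact_iff[OF N H Fm]
    using finitely_presented_projective[OF F N left_module_quotient_module[OF N H]
        quotient_map_hom[OF N H] carrier_quotient_module[OF N H, symmetric]]
    by blast
qed (rule M)

section \<open>Coherence\<close>

text \<open>A finitely generated ideal is \<open>Re\<close>, where \<open>e\<close> is the union of
  the generators. The map from \<open>R\<close> onto it that multiplies by \<open>e\<close> has as
  kernel the principal ideal generated by \<open>1 - e\<close>.\<close>

lemma left_coherent_set_ring: "left_coherent (set_ring \<A>)"
  unfolding left_coherent_def
proof (intro allI impI, elim conjE)
  let ?R = "set_ring \<A>"
  let ?M = "regular_module ?R" and ?E = "free_module ?R 1"
  fix I assume I: "submodule I ?R ?M" and fg: "finitely_generated ?R (sub_module ?M I)"
  interpret M: left_module ?R ?M by (rule left_module_regular_module[OF ring_set_ring])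
  have Im: "left_module ?R (sub_module ?M I)" by (rule left_module_sub_module[OF M.left_module_axioms I])
  interpret I: left_module ?R "sub_module ?M I" by (rule Im)
  have E: "left_module ?R ?E" by (rule left_module_free_module[OF ring_set_ring])
  interpret E: left_module ?R ?E by (rule E)
  have sub: "I \<subseteq> \<A>" using subgroup.subset[OF submodule.axioms(1)[OF I]] by simp
  have I0: "{} \<in> I" and sd: "\<And>x y. x \<in> I \<Longrightarrow> y \<in> I \<Longrightarrow> sym_diff x y \<in> I"
    and int: "\<And>r x. r \<in> \<A> \<Longrightarrow> x \<in> I \<Longrightarrow> r \<inter> x \<in> I"
    using I.M.zero_closed I.M.a_closed I.smult_closed by auto
  obtain A where A: "finite A" "A \<subseteq> I"
    "\<And>H. submodule H ?R (sub_module ?M I) \<Longrightarrow> A \<subseteq> H \<Longrightarrow> H = I"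
    using fg by (auto simp: finitely_generated_def)
  define e where "e = \<Union>A"
  have eI: "e \<in> I" unfolding e_def using A(1,2)
  proof (induction A rule: finite_induct)
    case (insert a A)
    have "- a \<inter> \<Union>A \<in> I" using insert sub by (intro int) auto
    \<comment> \<open>A union as a ring expression, \<open>a + (1 - a) b\<close>, which stays in the
      ideal.\<close>
    then have "sym_diff a (- a \<inter> \<Union>A) \<in> I" using insert by (intro sd) auto
    moreover have "sym_diff a (- a \<inter> \<Union>A) = \<Union>(insert a A)" by auto
    ultimately show ?case by metis
  qed (simp add: I0)
  then have e: "e \<in> \<A>" using sub by blast
  have "submodule {x \<in> I. x \<subseteq> e} ?R (sub_module ?M I)"
    by (rule I.left_submoduleI) (use I0 sd int in auto)
  then have "{x \<in> I. x \<subseteq> e} = I" by (rule A(3)) (use A(2) in \<open>auto simp: e_def\<close>)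
  then have Ie: "x \<subseteq> e" if "x \<in> I" for x using that by blast
  define p where "p = (\<lambda>v\<in>carrier ?E. v 0 \<inter> e)"
  have p: "p \<in> left_module_hom ?R ?E (sub_module ?M I)"
    by (rule left_module_homI) (auto simp: p_def free_module_def PiE_iff int eI)
  have "p ` carrier ?E = I"
  proof (intro equalityI subsetI)
    fix x assume x: "x \<in> I"
    then have "(\<lambda>i\<in>{..<1}. x) \<in> carrier ?E" "x = p (\<lambda>i\<in>{..<1}. x)"
      using sub Ie by (auto simp: p_def free_module_def)
    then show "x \<in> p ` carrier ?E" by blast
  qed (use left_module_homD(2)[OF p] in auto)
  moreover have "finitely_generated ?R (sub_module ?E (a_kernel ?E (sub_module ?M I) p))"
    unfolding finitely_generated_def
  proof (intro exI conjI allI impI)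
    \<comment> \<open>\<open>?g\<close> is \<open>1 - e\<close> as a vector of length one. An
      element of the kernel is disjoint from \<open>e\<close>, so multiplying \<open>?g\<close> by
      its entry gives it back.\<close>
    let ?K = "a_kernel ?E (sub_module ?M I) p" and ?g = "\<lambda>i\<in>{..<1::nat}. - e"
    have K: "v \<in> ?K \<longleftrightarrow> v \<in> carrier ?E \<and> v 0 \<inter> e = {}" for v
      by (auto simp: a_kernel_def' p_def)
    have "?g \<in> carrier ?E" using e by (simp add: free_module_def)
    then have "?g \<in> ?K" unfolding K by simp
    then show "{?g} \<subseteq> carrier (sub_module ?E ?K)" by simp
    fix H assume H: "submodule H ?R (sub_module ?E ?K) \<and> {?g} \<subseteq> H"
    have "v \<in> H" if v: "v \<in> ?K" for v
    proof -
      have "v 0 \<odot>\<^bsub>?E\<^esub> ?g = v" and v0: "v 0 \<in> \<A>"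
        using v[unfolded K] by (auto simp: free_module_def fun_eq_iff PiE_iff extensional_def)
      moreover have "v 0 \<odot>\<^bsub>?E\<^esub> ?g \<in> H"
        using H v0 submodule.smult_closed[of H ?R "sub_module ?E ?K" "v 0" ?g] by simp
      ultimately show ?thesis by metis
    qed
    moreover have "H \<subseteq> ?K" using H subgroup.subset[OF submodule.axioms(1), of H ?R "sub_module ?E ?K"] by simp
    ultimately show "H = carrier (sub_module ?E ?K)" by auto
  qed simp
  ultimately show "finitely_presented ?R (sub_module ?M I)"
    unfolding finitely_presented_def using Im p by (intro conjI exI[of _ 1] bexI[of _ p]) simp_all
qed

lemma right_coherent_set_ring: "right_coherent (set_ring \<A>)"
  by (simp add: right_coherent_def opposite_set_ring left_coherent_set_ring)

section \<open>Splitting of ideals\<close>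

text \<open>An element \<open>b\<close> of the ring splits every ideal \<open>I\<close> into
  \<open>bI\<close> and \<open>(1 - b)I\<close>. Without atoms, \<open>b\<close> can be chosen
  strictly inside a nonzero element of \<open>I\<close>, which makes both parts nonzero.\<close>

lemma atomless_not_indecomposable:
  assumes atomless: "\<And>A. A \<in> \<A> \<Longrightarrow> A \<noteq> {} \<Longrightarrow> \<exists>B\<in>\<A>. B \<noteq> {} \<and> B \<subset> A"
    and I: "submodule I (set_ring \<A>) (regular_module (set_ring \<A>))"
  shows "\<not> indecomposable (set_ring \<A>) (sub_module (regular_module (set_ring \<A>)) I)"
proof
  let ?R = "set_ring \<A>"
  let ?I = "sub_module (regular_module ?R) I"
  assume indec: "indecomposable ?R ?I"
  interpret M: left_module ?R "regular_module ?R" by (rule left_module_regular_module[OF ring_set_ring])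
  interpret I: left_module ?R ?I by (rule left_module_sub_module[OF M.left_module_axioms I])
  have sub: "I \<subseteq> \<A>" using subgroup.subset[OF submodule.axioms(1)[OF I]] by simp
  have I0: "{} \<in> I" and sd: "\<And>x y. x \<in> I \<Longrightarrow> y \<in> I \<Longrightarrow> sym_diff x y \<in> I"
    and int: "\<And>r x. r \<in> \<A> \<Longrightarrow> x \<in> I \<Longrightarrow> r \<inter> x \<in> I"
    using I.M.zero_closed I.M.a_closed I.smult_closed by auto
  obtain a where a: "a \<in> I" "a \<noteq> {}" using indec I0 by (auto simp: indecomposable_def)
  then obtain b where b: "b \<in> \<A>" "b \<noteq> {}" "b \<subset> a" using atomless[of a] sub by blast
  \<comment> \<open>For \<open>c\<close> in the ring this is \<open>cI\<close>; in this form it is a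
    submodule for every set \<open>c\<close>.\<close>
  define P where "P = (\<lambda>c. {x \<in> I. x \<subseteq> c})"
  have P: "submodule (P c) ?R ?I" for c
    unfolding P_def by (rule I.left_submoduleI) (use I0 sd int in auto)
  have "P b \<inter> P (- b) = {{}}" using I0 by (auto simp: P_def)
  moreover have "P b <+>\<^bsub>?I\<^esub> P (- b) = I"
  proof (intro equalityI subsetI)
    fix x assume x: "x \<in> I"
    have "b \<inter> x \<in> P b" "- b \<inter> x \<in> P (- b)" using x b(1) by (auto simp: P_def intro!: int)
    moreover have "x = sym_diff (b \<inter> x) (- b \<inter> x)" by auto
    ultimately show "x \<in> P b <+>\<^bsub>?I\<^esub> P (- b)" by (auto simp: set_add_def')
  qed (auto simp: set_add_def' P_def sd)
  ultimately have "P b = {{}} \<or> P (- b) = {{}}"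
    using indec P unfolding indecomposable_def by simp
  moreover have "b \<in> P b" using int[OF b(1) a(1)] b(3) by (auto simp: P_def Int_absorb2)
  moreover have "- b \<inter> a \<in> P (- b)" using int[of "- b" a] a(1) b(1) by (auto simp: P_def)
  moreover have "- b \<inter> a \<noteq> {}" using b(3) by blast
  ultimately show False using b(2) by (metis singletonD)
qed

end


section \<open>Periodic sets of natural numbers\<close>

text \<open>Periodicity is required from 0 on. Eventual periodicity would admit the singletons,
  which are atoms; a period 0 would admit every set.\<close>

definition periodic_sets :: "nat set set"
  where "periodic_sets = {A. \<exists>p>0. \<forall>n. n + p \<in> A \<longleftrightarrow> n \<in> A}"

lemma period_mult:
  fixes p :: nat
  assumes "\<And>n. n + p \<in> A \<longleftrightarrow> n \<in> A"
  shows "n + k * p \<in> A \<longleftrightarrow> n \<in> A"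
proof (induction k)
  case (Suc k)
  have "n + Suc k * p = (n + k * p) + p" by simp
  with Suc assms show ?case by metis
qed simp

lemma field_of_sets_periodic_sets: "field_of_sets periodic_sets"
proof
  fix A B assume "A \<in> periodic_sets" "B \<in> periodic_sets"
  then obtain p q where p: "p > 0" "\<And>n. n + p \<in> A \<longleftrightarrow> n \<in> A"
    and q: "q > 0" "\<And>n. n + q \<in> B \<longleftrightarrow> n \<in> B" by (auto simp: periodic_sets_def)
  \<comment> \<open>The product of the two periods is a common period.\<close>
  have "n + p * q \<in> A \<inter> B \<longleftrightarrow> n \<in> A \<inter> B" for n
    using period_mult[OF p(2), of n q] period_mult[OF q(2), of n p] by (simp add: mult.commute)
  then show "A \<inter> B \<in> periodic_sets"
    unfolding periodic_sets_def using p(1) q(1) by (auto intro!: exI[of _ "p * q"])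
qed (auto simp: periodic_sets_def)

lemma periodic_sets_atomless:
  assumes "A \<in> periodic_sets" "A \<noteq> {}"
  shows "\<exists>B\<in>periodic_sets. B \<noteq> {} \<and> B \<subset> A"
proof -
  obtain p where p: "p > 0" "\<And>n. n + p \<in> A \<longleftrightarrow> n \<in> A" using assms(1) by (auto simp: periodic_sets_def)
  obtain a where a: "a \<in> A" using assms(2) by blast
  \<comment> \<open>After doubling the period, \<open>a\<close> and \<open>a + p\<close> lie in
    different residue classes, although both belong to \<open>A\<close>; keeping only the class of
    \<open>a\<close> gives a proper subset.\<close>
  define B where "B = {n \<in> A. n mod (2 * p) = a mod (2 * p)}"
  have "n + 2 * p \<in> B \<longleftrightarrow> n \<in> B" for n
    using period_mult[OF p(2), of n 2] by (simp add: B_def)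
  then have "B \<in> periodic_sets" unfolding periodic_sets_def using p(1) by (auto intro!: exI[of _ "2 * p"])
  moreover have "a \<in> B" using a by (simp add: B_def)
  moreover have "a + p \<notin> B"
  proof
    assume "a + p \<in> B"
    then have "2 * p dvd (a + p) - a" unfolding B_def by (metis (lifting) mem_Collect_eq mod_eq_dvd_iff_nat le_add1)
    then show False using p(1) by (auto dest: dvd_imp_le)
  qed
  moreover have "a + p \<in> A" using p(2) a by simp
  moreover have "B \<subseteq> A" by (auto simp: B_def)
  ultimately show ?thesis by blast
qed

theorem corollary3p8:
  shows "\<exists>(R :: nat set ring) (M :: (nat set, nat set) module).
    ring R \<and> left_coherent R \<and> right_coherent R \<and> absolutely_pure R M \<and>
    \<not> (\<exists>\<N>. internal_direct_sum R M \<N> \<and>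
          (\<forall>N\<in>\<N>. indecomposable R (sub_module M N) \<and> absolutely_pure R (sub_module M N)))"
proof -
  interpret field_of_sets periodic_sets by (rule field_of_sets_periodic_sets)
  let ?R = "set_ring periodic_sets"
  let ?M = "regular_module ?R"
  have M: "left_module ?R ?M" by (rule left_module_regular_module[OF ring_set_ring])
  interpret M: left_module ?R ?M by (rule M)
  have False if ds: "internal_direct_sum ?R ?M \<N>"
    and indec: "\<And>N. N \<in> \<N> \<Longrightarrow> indecomposable ?R (sub_module ?M N)" for \<N>
  proof -
    \<comment> \<open>Every member would be an indecomposable ideal, and there is none. What remains
      is the empty family, whose only sum is zero, while \<open>UNIV\<close> is a nonzero element of
      \<open>?M\<close>.\<close>
    have "N \<notin> \<N>" for N
      using atomless_not_indecomposable[OF periodic_sets_atomless, of N] ds indec[of N]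
      by (auto simp: internal_direct_sum_def)
    then have N: "\<N> = {}" by blast
    from bspec[OF conjunct2[OF ds[unfolded internal_direct_sum_def N]], of UNIV] show False
      by auto
  qed
  then show ?thesis
    using ring_set_ring left_coherent_set_ring right_coherent_set_ring absolutely_pure_module[OF M]
    by blast
qed

end
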